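(* Let $\mathbf P$ and $\mathbf Q$ be stationary hidden-Markov measures on $\mathcal A^{\mathbf N}$ ($\mathcal A$ a finite set), each admitting a representation with a finite hidden alphabet and an irreducible hidden Markov chain. Suppose that $\operatorname{supp}\mathbf Q\subseteq\operatorname{supp}\mathbf P$ and that the pair $(\mathbf P,\mathbf Q)$ is nondegenerate (ND), i.e. $\overline q(-1)<0$. Then $$\lim_{N\to\infty}Q_N(y,x)=h_{\mathrm c}(\mathbf Q|\mathbf P)$$ for $(\mathbf P\otimes\mathbf Q)$-almost every $(x,y)$, where $Q_N$ is the modified Ziv--Merhav estimator and $h_{\mathrm c}(\mathbf Q|\mathbf P)$ is the specific cross entropy.
   Context: Notation. $\mathcal A$ is a finite set, $\mathbf N=\{1,2,\dots\}$, $\mathcal A^{\mathbf N}$ carries the product $\sigma$-algebra. For $x=(x_k)_{k\ge1}$ write $x_i^j=x_i\cdots x_j$. For $a\in\mathcal A^n$, $[a]=\{x:x_1^n=a\}$ and $\mathbf P[a]=\mathbf P([a])$. $\operatorname{supp}\mathbf P_n=\{a\in\mathcal A^n:\mathbf P[a]>0\}$ and $\operatorname{supp}\mathbf P=\{x:\mathbf P[x_1^n]>0\text{ for all }n\}$; similarly for $\mathbf Q$. Stationary hidden-Markov measure (with finite hidden alphabet): a measure $\mathbf P$ for which there is a tuple $(\pi,P,R)$ where $(\pi,P)$ is a stationary Markov chain on a finite set $\mathcal S$ (initial distribution $\pi=\pi P$, transition matrix $P$), $R$ is a nonnegative $(\#\mathcal S)\times(\#\mathcal A)$ matrix whose rows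 each sum to $1$, and $\mathbf P[a_1^n]=\sum_{s_1^n\in\mathcal S^n}\pi_{s_1}R_{s_1,a_1}P_{s_1,s_2}R_{s_2,a_2}\cdots P_{s_{n-1},s_n}R_{s_n,a_n}$ for all $n\in\mathbf N$ and $a_1^n\in\mathcal A^n$. The representation is irreducible if $P$ is irreducible. (The case where $R$ has only entries $0$ and $1$ is that of functions of Markov chains.) Cross-entropic pressure: $q_n(\alpha)=\ln\sum_{a\in\operatorname{supp}\mathbf P_n}\mathbf P[a]^{-\alpha}\mathbf Q[a]$ and $\overline q(\alpha)=\limsup_{n\to\infty}\frac1nq_n(\alpha)$. Cross entropy: $h_{\mathrm c}(\mathbf Q|\mathbf P)=\lim_{n\to\infty}-\frac1n\sum_{a\in\mathcal A^n}\mathbf Q[a]\ln\mathbf P[a]$ (the limit exists in $[0,\infty]$ in this setting; terms with $\mathbf Q[a]=0$ are $0$). Modified Ziv--Merhav (mZM) parsing of $y_1^N$ with respect to $x_1^N$: the first word is the shortest prefix of $y_1^N$ that does not appear as a contiguous substring of $x_1^N$, or all of $y_1^N$ if no such prefix exists (in which case the procedure terminates). Given that the first $i$ words have lengths summing to $L_i<N$, the next word is the shortest prefix of $y_{L_i+1}^N$ that does not appear as a contiguous substring of $x_1^N$, or all of $y_{L_i+1}^N$ if no such prefix exists (in which case the procedure terminates). The procedure stops once all of $y_1^N$ is parsed. $c_N=c_N(y|x)$ is the number of words, and $Q_N(y,x)=\frac{c_N(y|x)\ln N}{N-c_N(y|x)}$ (understood as $+\infty$ if $c_N=N$). *)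

theory Defs
  imports "HOL-Probability.Probability" "HOL-Library.Sublist"
begin

text \<open>Sequences are functions \<open>x :: nat \<Rightarrow> 'a\<close> with index shifted by one: the letter
  \<open>x\<^sub>k\<close>, \<open>k \<ge> 1\<close>, is \<open>x (k - 1)\<close>. Words are lists, so \<open>x\<^sub>1 \<dots> x\<^sub>n\<close> is \<open>initial_word n x\<close>.\<close>

definition sequence_algebra :: "(nat \<Rightarrow> 'a) measure" where
  "sequence_algebra = PiM UNIV (\<lambda>_. count_space UNIV)"

definition initial_word :: "nat \<Rightarrow> (nat \<Rightarrow> 'a) \<Rightarrow> 'a list" where
  "initial_word n x = map x [0..<n]"

definition cylinder :: "'a list \<Rightarrow> (nat \<Rightarrow> 'a) set" where
  "cylinder a = {x. initial_word (length a) x = a}"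

definition word_prob :: "(nat \<Rightarrow> 'a) measure \<Rightarrow> 'a list \<Rightarrow> real" where
  "word_prob P a = measure P (cylinder a)"

definition word_supp :: "(nat \<Rightarrow> 'a) measure \<Rightarrow> nat \<Rightarrow> 'a list set" where
  "word_supp P n = {a. length a = n \<and> word_prob P a > 0}"

definition seq_supp :: "(nat \<Rightarrow> 'a) measure \<Rightarrow> (nat \<Rightarrow> 'a) set" where
  "seq_supp P = {x. \<forall>n\<ge>1. word_prob P (initial_word n x) > 0}"


definition stochastic_matrix :: "real ^ 'm ^ 'n \<Rightarrow> bool" where
  "stochastic_matrix A \<longleftrightarrow> (\<forall>i j. A $ i $ j \<ge> 0) \<and> (\<forall>i. (\<Sum>j\<in>UNIV. A $ i $ j) = 1)"

definition stationary_markov_chain :: "real ^ 's \<Rightarrow> real ^ 's ^ 's \<Rightarrow> bool" where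
  "stationary_markov_chain p T \<longleftrightarrow>
     (\<forall>s. p $ s \<ge> 0) \<and> (\<Sum>s\<in>UNIV. p $ s) = 1 \<and> stochastic_matrix T \<and> p = p v* T"

definition matrix_power :: "real ^ 's ^ 's \<Rightarrow> nat \<Rightarrow> real ^ 's ^ 's" where
  "matrix_power T n = ((\<lambda>A. A ** T) ^^ n) (mat 1)"

definition irreducible_matrix :: "real ^ 's ^ 's \<Rightarrow> bool" where
  "irreducible_matrix T \<longleftrightarrow> (\<forall>s t. \<exists>n\<ge>1. matrix_power T n $ s $ t > 0)"

text \<open>The hidden alphabet is the finite index type \<open>'s\<close>; it is unrelated to the type of letters.\<close>

definition hidden_markov_rep ::
  "(nat \<Rightarrow> 'a::finite) measure \<Rightarrow> real ^ 's \<Rightarrow> real ^ 's ^ 's \<Rightarrow> real ^ 'a ^ 's \<Rightarrow> bool" where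
  "hidden_markov_rep P p T R \<longleftrightarrow>
     prob_space P \<and> sets P = sets sequence_algebra \<and>
     stationary_markov_chain p T \<and> stochastic_matrix R \<and>
     (\<forall>n\<ge>1. \<forall>a. length a = n \<longrightarrow>
        word_prob P a =
          (\<Sum>s | length s = n.
             p $ (s ! 0) * R $ (s ! 0) $ (a ! 0) *
             (\<Prod>k<n - 1. T $ (s ! k) $ (s ! Suc k) * R $ (s ! Suc k) $ (a ! Suc k))))"


text \<open>Logarithm of a nonnegative real with \<open>ln 0 = -\<infinity>\<close> (the library has \<open>ln 0 = 0\<close> on the reals).\<close>

definition eln :: "real \<Rightarrow> ereal" where
  "eln t = (if t = 0 then - \<infinity> else ereal (ln t))"

definition cross_pressure_n ::
  "(nat \<Rightarrow> 'a::finite) measure \<Rightarrow> (nat \<Rightarrow> 'a) measure \<Rightarrow> nat \<Rightarrow> real \<Rightarrow> ereal" where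
  "cross_pressure_n P Q n \<alpha> = eln (\<Sum>a\<in>word_supp P n. word_prob P a powr (- \<alpha>) * word_prob Q a)"

definition upper_cross_pressure ::
  "(nat \<Rightarrow> 'a::finite) measure \<Rightarrow> (nat \<Rightarrow> 'a) measure \<Rightarrow> real \<Rightarrow> ereal" where
  "upper_cross_pressure P Q \<alpha> = limsup (\<lambda>n. ereal (1 / real n) * cross_pressure_n P Q n \<alpha>)"

definition nondegenerate :: "(nat \<Rightarrow> 'a::finite) measure \<Rightarrow> (nat \<Rightarrow> 'a) measure \<Rightarrow> bool" where
  "nondegenerate P Q \<longleftrightarrow> upper_cross_pressure P Q (- 1) < 0"

text \<open>In \<^typ>\<open>ereal\<close>, \<open>0 * (-\<infinity>) = 0\<close>, so terms with vanishing \<open>Q\<close>-probability are \<open>0\<close>;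
  all terms are nonpositive, so the sum is never of the form \<open>\<infinity> - \<infinity>\<close>.\<close>

definition cross_entropy ::
  "(nat \<Rightarrow> 'a::finite) measure \<Rightarrow> (nat \<Rightarrow> 'a) measure \<Rightarrow> ereal" where
  "cross_entropy Q P =
     lim (\<lambda>n. ereal (- 1 / real n) * (\<Sum>a | length a = n. ereal (word_prob Q a) * eln (word_prob P a)))"


definition mzm_word :: "'a list \<Rightarrow> 'a list \<Rightarrow> 'a list" where
  "mzm_word x y =
     (if \<exists>k\<le>length y. \<not> sublist (take k y) x
      then take (LEAST k. \<not> sublist (take k y) x) y
      else y)"

lemma mzm_word_nonempty:
  assumes "y \<noteq> []"
  shows "mzm_word x y \<noteq> []"
proof (cases "\<exists>k\<le>length y. \<not> sublist (take k y) x")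
  case True
  define m where "m = (LEAST k. \<not> sublist (take k y) x)"
  from True have "\<not> sublist (take m y) x"
    unfolding m_def by (metis (mono_tags, lifting) LeastI_ex)
  then have "take m y \<noteq> []"
    by auto
  with True show ?thesis
    by (auto simp: mzm_word_def m_def)
next
  case False
  with assms show ?thesis
    unfolding mzm_word_def by argo
qed

text \<open>\<open>mzm_parse x y\<close> is the list of words in the parsing of \<open>y\<close> with respect to \<open>x\<close>.\<close>

function mzm_parse :: "'a list \<Rightarrow> 'a list \<Rightarrow> 'a list list" where
  "mzm_parse x y =
     (if y = [] then [] else mzm_word x y # mzm_parse x (drop (length (mzm_word x y)) y))"
  by auto
termination
  by (relation "Wellfounded.measure (\<lambda>(x, y). length y)") (auto simp: mzm_word_nonempty)

declare mzm_parse.simps [simp del]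

definition mzm_count :: "nat \<Rightarrow> (nat \<Rightarrow> 'a) \<Rightarrow> (nat \<Rightarrow> 'a) \<Rightarrow> nat" where
  "mzm_count N y x = length (mzm_parse (initial_word N x) (initial_word N y))"

definition mzm_estimator :: "nat \<Rightarrow> (nat \<Rightarrow> 'a) \<Rightarrow> (nat \<Rightarrow> 'a) \<Rightarrow> ereal" where
  "mzm_estimator N y x =
     (let c = mzm_count N y x
      in if c = N then \<infinity> else ereal (real c * ln (real N) / (real N - real c)))"

end

(* The function f(w) = - ln P[w] of words is superadditive up to a constant, because P[uv] <= C P[u] P[v]
   for an irreducible hidden chain. Write h for the cross entropy and c for the number of words in the
   parsing of y_1^N; all words have length O(ln N) because of (ND).

   c ln N <= (h + o(1)) N: by irreducibility, a word with P[w] >= N^(-1+eps) is missing in x_1^N with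
   tiny probability, so every parsed word (but the last) has f(w) >= (1-eps) ln N. Superadditivity gives
   c ((1-eps) ln N - ln C) <= f(y_1^N), and f(y_1^N) <= (h + o(1)) N is the subadditive ergodic theorem.

   c ln N >= (h - o(1)) N: a parsed word without its last letter occurs in x_1^N. By a first moment bound,
   only a fraction N^(-eps/2) of the positions of y start a common word with P[w] <= N^(-1-eps) (along
   N = 2^i, which suffices because occurrence is monotone in N). All other words satisfy
   f(w) <= (1+eps) ln N up to the last letter. Averaging over the phases of a division into blocks of
   length k, f(w) is at least 1/k times the sum of f over the windows of length k inside w, up to
   |w| (ln C) / k. Only O(c) windows straddle two words, so the ergodic theorem for
   window sums bounds the sum of the f(w) from below by about N h. *)
theory Submission
  imports Defs "HOL-Real_Asymp.Real_Asymp"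
begin

section \<open>Superadditive sequences and the subadditive ergodic theorem\<close>

text \<open>An irreducible chain may be periodic, so there is no mixing to rely on. It is replaced
  by return within a bounded but variable gap: from any hidden state, any word follows after some
  gap j \<le> \<tau> with probability at least a constant times its own. This yields both the
  ergodicity of the shift and the exponential bound for avoiding a word.

  Superadditivity is one-sided: f(y_1^N) may exceed the sum of f over the parsed words by more than
  a constant per word. For the lower bound on c, it is therefore replaced by an additive functional,
  the sum over windows. Both uses of the ergodic theorem then ask for a lower bound on a subadditive
  process, ln C - f in one case and the window sums in the other, and one half of that theorem
  covers both.

  Independence of x and y lets every event be estimated for a fixed word w and then weighted by
  Q[w], so the exponential number of words never enters. The dyadic N are forced by the first moment
  bound, since N^(-eps/2) need not be summable over all N.\<close>

lemma superadditive_sum_blocks: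
  fixes e :: "nat \<Rightarrow> real"
  assumes super: "\<And>m n. e (m + n) \<ge> e m + e n - c" and nonneg: "\<And>n. e n \<ge> 0"
  shows "e (q * k + r) \<ge> real q * (e k - c)"
proof (induction q)
  case (Suc q)
  then show ?case
    using super[of k "q * k + r"] by (simp add: algebra_simps)
qed (simp add: nonneg)

text \<open>Fekete's lemma for \<open>e - c\<close>, which is superadditive without error. Its limit
  is a supremum, so besides convergence one gets \<open>e n - c \<le> h * real n\<close> for every
  single n; this exact form provides the mean hypothesis of the ergodic theorem.\<close>

lemma superadditive_tendsto:
  fixes e :: "nat \<Rightarrow> real"
  assumes super: "\<And>m n. e (m + n) \<ge> e m + e n - c" and nonneg: "\<And>n. e n \<ge> 0" and "c \<ge> 0"
    and bound: "\<And>n. e n \<le> K * real n"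
  shows "\<exists>h. (\<lambda>n. e n / real n) \<longlonglongrightarrow> h \<and> (\<forall>n\<ge>1. e n - c \<le> h * real n)"
proof -
  define h where "h = (SUP n\<in>{1..}. (e n - c) / real n)"
  have bdd: "bdd_above ((\<lambda>n. (e n - c) / real n) ` {1..})"
    using bound \<open>c \<ge> 0\<close> by (intro bdd_aboveI2[of _ _ K]) (smt (verit) atLeast_iff divide_le_eq of_nat_0_less_iff zero_less_one_class.zero_le_one less_le_trans less_numeral_extra(1))
  have le_h: "e n - c \<le> h * real n" if "n \<ge> 1" for n
    using cSUP_upper[OF _ bdd, of n] that by (simp add: h_def field_simps)
  have lower: "\<forall>\<^sub>F n in sequentially. e n / real n > a" if "a < h" for a
  proof -
    have "\<exists>k\<in>{1..}. a < (e k - c) / real k"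
      using that less_cSUP_iff[OF _ bdd, of a] by (simp add: h_def)
    then obtain k where k: "k \<ge> 1" "a < (e k - c) / real k"
      by auto
    define b where "b = (e k - c) / real k"
    have "(\<lambda>n. b - (\<bar>b\<bar> * real k) / real n) \<longlonglongrightarrow> b - 0"
      by (intro tendsto_intros lim_const_over_n)
    then have "\<forall>\<^sub>F n in sequentially. b - (\<bar>b\<bar> * real k) / real n > a"
      using k by (intro order_tendstoD) (auto simp: b_def)
    then show ?thesis
      using eventually_gt_at_top[of 0]
    proof eventually_elim
      case (elim n)
      have "e n \<ge> real (n div k) * (b * real k)"
        using superadditive_sum_blocks[of e c "n div k" k "n mod k", OF super nonneg] k by (simp add: b_def)
      also have "real (n div k) * (b * real k) = b * real n - b * real (n mod k)"
      proof -
        have "real n = real (n div k) * real k + real (n mod k)"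
          by (metis of_nat_add of_nat_mult div_mult_mod_eq)
        then show ?thesis
          by (simp add: algebra_simps)
      qed
      finally have "e n \<ge> b * real n - b * real (n mod k)" .
      moreover have "b * real (n mod k) \<le> \<bar>b\<bar> * real k"
        using k by (intro mult_mono) (auto intro: less_imp_le)
      ultimately have "e n \<ge> b * real n - \<bar>b\<bar> * real k"
        by simp
      moreover have "a * real n < b * real n - \<bar>b\<bar> * real k"
        using elim by (simp add: field_simps)
      ultimately show ?case
        using elim by (simp add: field_simps)
    qed
  qed
  have upper: "\<forall>\<^sub>F n in sequentially. e n / real n < a" if "h < a" for a
  proof -
    have "(\<lambda>n. h + c / real n) \<longlonglongrightarrow> h + 0"
      by (intro tendsto_intros lim_const_over_n)
    then have "\<forall>\<^sub>F n in sequentially. h + c / real n < a"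
      using that by (intro order_tendstoD) auto
    then show ?thesis
      using eventually_gt_at_top[of 0]
    proof eventually_elim
      case (elim n)
      then have "e n / real n \<le> h + c / real n"
        using le_h[of n] by (simp add: field_simps)
      then show ?case
        using elim by simp
    qed
  qed
  show ?thesis
    using lower upper le_h by (intro exI[of _ h] conjI order_tendstoI) auto
qed

text \<open>The orbit of length \<open>N\<close> is cut greedily into pieces of length at most \<open>M\<close> on which
  \<open>g \<le> 0\<close>, single bad points and a remainder of length at most \<open>M\<close>.\<close>

lemma covering_bound:
  fixes g :: "nat \<Rightarrow> 'b \<Rightarrow> real"
  assumes sub: "\<And>m n x. m \<ge> 1 \<Longrightarrow> n \<ge> 1 \<Longrightarrow> g (m + n) x \<le> g m x + g n ((T ^^ m) x)"
    and le: "\<And>n x. n \<ge> 1 \<Longrightarrow> g n x \<le> D * real n" and "D \<ge> 0" "M \<ge> 1" "N \<ge> 1"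
  shows "g N x \<le> D * (\<Sum>j<N. indicator {x. \<forall>n\<in>{1..M}. g n x > 0} ((T ^^ j) x)) + D * real M"
  using \<open>N \<ge> 1\<close>
proof (induction N arbitrary: x rule: less_induct)
  case (less N)
  let ?B = "{x. \<forall>n\<in>{1..M}. g n x > 0}"
  let ?S = "\<lambda>N x. \<Sum>j<N. indicator ?B ((T ^^ j) x) :: real"
  have S0: "?S n x \<ge> 0" for n x
    by (intro sum_nonneg) simp
  have S_add: "?S N x = ?S m x + ?S (N - m) ((T ^^ m) x)" if "m \<le> N" for m
  proof -
    have "?S N x = ?S m x + (\<Sum>j\<in>{m..<N}. indicator ?B ((T ^^ j) x))"
      using that by (subst sum.union_disjoint[symmetric]) (auto intro!: sum.cong)
    also have "(\<Sum>j\<in>{m..<N}. indicator ?B ((T ^^ j) x) :: real) = ?S (N - m) ((T ^^ m) x)"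
      by (rule sum.reindex_bij_witness[where i="\<lambda>j. j + m" and j="\<lambda>j. j - m"])
        (auto simp: funpow_add[THEN fun_cong, simplified, symmetric])
    finally show ?thesis .
  qed
  show ?case
  proof (cases "N \<le> M")
    case True
    have "g N x \<le> D * real N"
      using less.prems by (rule le)
    also have "\<dots> \<le> D * real M"
      using True \<open>D \<ge> 0\<close> by (intro mult_left_mono) auto
    finally show ?thesis
      using mult_nonneg_nonneg[OF \<open>D \<ge> 0\<close> S0[where n=N and x=x]] by linarith
  next
    case False
    show ?thesis
    proof (cases "x \<in> ?B")
      case True
      have "g (1 + (N - 1)) x \<le> g 1 x + g (N - 1) ((T ^^ 1) x)"
        using False \<open>M \<ge> 1\<close> by (intro sub) auto
      also have "g 1 x \<le> D * 1"
        using le[of 1 x] by simp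
      also have "g (N - 1) ((T ^^ 1) x) \<le> D * ?S (N - 1) ((T ^^ 1) x) + D * real M"
        using False \<open>M \<ge> 1\<close> by (intro less.IH) auto
      finally have "g N x \<le> D * (1 + ?S (N - 1) ((T ^^ 1) x)) + D * real M"
        using less.prems by (simp add: algebra_simps)
      also have "1 + ?S (N - 1) ((T ^^ 1) x) = ?S N x"
        using S_add[of 1] True less.prems by simp
      finally show ?thesis .
    next
      case notB: False
      then obtain m where m: "m \<ge> 1" "m \<le> M" "g m x \<le> 0"
        by (auto simp: not_less)
      have "g (m + (N - m)) x \<le> g m x + g (N - m) ((T ^^ m) x)"
        using False m by (intro sub) auto
      also have "g (N - m) ((T ^^ m) x) \<le> D * ?S (N - m) ((T ^^ m) x) + D * real M"
        using False m by (intro less.IH) auto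
      finally have "g N x \<le> D * ?S (N - m) ((T ^^ m) x) + D * real M"
        using m False by simp
      also have "D * ?S (N - m) ((T ^^ m) x) \<le> D * ?S N x"
        using S_add[of m] S0[where n=m and x=x] False m \<open>D \<ge> 0\<close> by (intro mult_left_mono) auto
      finally show ?thesis
        by simp
    qed
  qed
qed

text \<open>The lower half of Kingman's theorem, by a covering argument. If the lower limit
  \<open>L\<close> were below \<beta> with positive probability, it would be so almost surely. Then
  nearly every point begins a piece of bounded length on which F is at most \<beta> times the
  length, and cutting orbits into such pieces pushes the mean of \<open>F N\<close> below \<gamma>
  N. Ergodicity is assumed for sets containing their own preimage, because \<open>L\<close> is only
  known not to decrease along orbits.\<close>

theorem (in prob_space) subadditive_ergodic_lower:
  fixes F :: "nat \<Rightarrow> 'a \<Rightarrow> real"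
  assumes meas_T [measurable]: "T \<in> measurable M M"
    and pres: "\<And>m B. B \<in> sets M \<Longrightarrow> prob ((T ^^ m) -` B \<inter> space M) = prob B"
    and ergodic: "\<And>A. A \<in> sets M \<Longrightarrow> T -` A \<inter> space M \<subseteq> A \<Longrightarrow> prob A = 0 \<or> prob A = 1"
    and meas_F [measurable]: "\<And>n. F n \<in> borel_measurable M"
    and sub: "\<And>m n x. m \<ge> 1 \<Longrightarrow> n \<ge> 1 \<Longrightarrow> F (m + n) x \<le> F m x + F n ((T ^^ m) x)"
    and bound: "\<And>n x. n \<ge> 1 \<Longrightarrow> \<bar>F n x\<bar> \<le> K * real n"
    and mean: "\<And>n. n \<ge> 1 \<Longrightarrow> expectation (F n) \<ge> \<gamma> * real n"
    and "\<gamma>' < \<gamma>"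
  shows "AE x in M. \<forall>\<^sub>F n in sequentially. F n x \<ge> \<gamma>' * real n"
proof -
  \<comment> \<open>A level strictly in between: below \<gamma> to contradict the mean, above
    \<gamma>' so that a lower limit of at least \<beta> gives the bound eventually.\<close>
  define \<beta> where "\<beta> = (\<gamma>' + \<gamma>) / 2"
  have \<beta>: "\<gamma>' < \<beta>" "\<beta> < \<gamma>"
    using \<open>\<gamma>' < \<gamma>\<close> by (auto simp: \<beta>_def)
  have Tm [measurable]: "(T ^^ m) \<in> measurable M M" for m
    by (induction m) (auto intro!: measurable_comp[OF _ meas_T] simp: id_def)
  have K: "K \<ge> 0"
    using bound[of 1 undefined] by simp
  define L where "L x = liminf (\<lambda>n. ereal (F n x / real n))" for x
  have L_meas [measurable]: "L \<in> borel_measurable M"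
    unfolding L_def by measurable
  define A where "A = {x\<in>space M. L x < ereal \<beta>}"
  have A [measurable]: "A \<in> sets M"
    unfolding A_def by measurable
  have L_T: "L x \<le> L (T x)" for x
  proof -
    have "L x = liminf (\<lambda>n. ereal (F (Suc n) x / real (Suc n)))"
      unfolding L_def using liminf_shift[of "\<lambda>n. ereal (F n x / real n)"] by simp
    \<comment> \<open>The first step of the orbit costs at most K / n, and dividing by n instead of
      n + 1 another K / n, because \<open>F n\<close> is at most K n in absolute value.\<close>
    also have "\<dots> \<le> liminf (\<lambda>n. ereal (2 * K / real n) + ereal (F n (T x) / real n))"
    proof (rule Liminf_mono)
      show "\<forall>\<^sub>F n in sequentially. ereal (F (Suc n) x / real (Suc n))
          \<le> ereal (2 * K / real n) + ereal (F n (T x) / real n)"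
        using eventually_ge_at_top[of 1]
      proof eventually_elim
        case (elim n)
        have "F (Suc n) x \<le> K + F n (T x)"
          using sub[of 1 n x] bound[of 1 x] elim by simp
        then have "F (Suc n) x * real n \<le> (K + F n (T x)) * real n"
          using elim by (intro mult_right_mono) auto
        moreover have "- F n (T x) \<le> K * real n"
          using bound[of n "T x"] elim by simp
        ultimately have "F (Suc n) x * real n \<le> (F n (T x) + 2 * K) * (real n + 1)"
          using K by (simp add: algebra_simps)
        then show ?case
          using elim by (simp add: field_simps)
      qed
    qed
    also have "\<dots> = 0 + L (T x)"
      unfolding L_def
      by (rule ereal_liminf_lim_add)
        (auto simp: zero_ereal_def intro!: tendsto_ereal lim_const_over_n)
    finally show ?thesis
      by simp
  qed
  have "prob A = 0"
  proof (rule ccontr)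
    assume "prob A \<noteq> 0"
    moreover have "T -` A \<inter> space M \<subseteq> A"
      using L_T measurable_space[OF meas_T] by (auto simp: A_def intro: le_less_trans)
    ultimately have prob_A: "prob A = 1"
      using ergodic A by blast
    define g where "g n x = F n x - \<beta> * real n" for n x
    define B where "B m = {x\<in>space M. \<forall>n\<in>{1..m}. g n x > 0}" for m
    have B_meas [measurable]: "B m \<in> sets M" for m
      unfolding B_def g_def by measurable
    have "(\<lambda>m. prob (B m)) \<longlonglongrightarrow> prob (\<Inter>m. B m)"
    proof (rule finite_Lim_measure_decseq)
      show "range B \<subseteq> events"
        using B_meas by blast
      show "decseq B"
        by (auto simp: decseq_def B_def)
    qed
    moreover have "prob (\<Inter>m. B m) = 0"
    proof -
      have "(\<Inter>m. B m) \<subseteq> space M - A"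
      proof
        fix x assume x: "x \<in> (\<Inter>m. B m)"
        have pos: "g n x > 0" if "n \<ge> 1" for n
        proof -
          have "x \<in> B n"
            using x by blast
          then show ?thesis
            using that by (simp add: B_def)
        qed
        have "L x \<ge> ereal \<beta>"
          unfolding L_def
        proof (rule Liminf_bounded)
          show "\<forall>\<^sub>F n in sequentially. ereal \<beta> \<le> ereal (F n x / real n)"
            using eventually_ge_at_top[of 1]
          proof eventually_elim
            case (elim n)
            then show ?case
              using pos[of n] by (simp add: g_def field_simps)
          qed
        qed
        then show "x \<in> space M - A"
          using x by (auto simp: A_def B_def)
      qed
      then have "prob (\<Inter>m. B m) \<le> prob (space M - A)"
        by (intro finite_measure_mono) auto
      then show ?thesis
        using prob_A prob_compl[OF A] by (simp add: antisym)
    qed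
    ultimately have B0: "(\<lambda>m. prob (B m)) \<longlonglongrightarrow> 0"
      by simp
    define D where "D = K + \<bar>\<beta>\<bar>"
    have D: "D \<ge> 0"
      using K by (simp add: D_def)
    have "\<forall>\<^sub>F m in sequentially. D * prob (B m) < \<gamma> - \<beta>"
      using tendsto_mult_left[OF B0, of D] \<beta> by (intro order_tendstoD) auto
    then have "\<forall>\<^sub>F m in sequentially. D * prob (B m) < \<gamma> - \<beta> \<and> m \<ge> 1"
      using eventually_ge_at_top[of 1] by eventually_elim auto
    \<comment> \<open>Points that start no good piece of length at most m cost
      \<open>D * prob (B m)\<close> per step on average, which must stay below the gain \<gamma> -
      \<beta>.\<close>
    then obtain m where m: "D * prob (B m) < \<gamma> - \<beta>" "m \<ge> 1"
      using eventually_happens'[OF sequentially_bot] by blast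
    have int_F: "integrable M (F n)" if "n \<ge> 1" for n
      using bound[OF that] by (intro integrable_const_bound[of _ "K * real n"]) auto
    have "(\<gamma> - \<beta>) * real N \<le> D * prob (B m) * real N + D * real m" if N: "N \<ge> 1" for N
    proof -
      have int_B: "integrable M (\<lambda>x. indicator (B m) ((T ^^ j) x) :: real)" for j
        by (intro integrable_const_bound[of _ 1]) auto
      have "F N x - \<beta> * real N \<le> D * (\<Sum>j<N. indicator (B m) ((T ^^ j) x)) + D * real m" if "x \<in> space M" for x
      proof -
        have "g N x \<le> D * (\<Sum>j<N. indicator {x. \<forall>n\<in>{1..m}. g n x > 0} ((T ^^ j) x)) + D * real m"
        proof (rule covering_bound)
          fix k n :: nat and x assume "k \<ge> 1" "n \<ge> 1"
          then show "g (k + n) x \<le> g k x + g n ((T ^^ k) x)"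
            using sub[of k n x] by (simp add: g_def algebra_simps)
        next
          fix n :: nat and x assume "n \<ge> 1"
          then have "F n x \<le> K * real n" "- \<beta> * real n \<le> \<bar>\<beta>\<bar> * real n"
            using bound[of n x] mult_right_mono[of "- \<beta>" "\<bar>\<beta>\<bar>" "real n"] by auto
          then show "g n x \<le> D * real n"
            by (simp add: g_def D_def algebra_simps)
        qed (use D m N in auto)
        also have "(\<Sum>j<N. indicator {x. \<forall>n\<in>{1..m}. g n x > 0} ((T ^^ j) x) :: real) = (\<Sum>j<N. indicator (B m) ((T ^^ j) x))"
          using measurable_space[OF Tm \<open>x \<in> space M\<close>] by (intro sum.cong) (auto simp: B_def indicator_def)
        finally show ?thesis
          by (simp add: g_def)
      qed
      then have "expectation (\<lambda>x. F N x - \<beta> * real N) \<le>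
        expectation (\<lambda>x. D * (\<Sum>j<N. indicator (B m) ((T ^^ j) x)) + D * real m)"
        using int_F[OF N] int_B by (intro integral_mono) auto
      also have "\<dots> = D * (\<Sum>j<N. expectation (\<lambda>x. indicator (B m) ((T ^^ j) x))) + D * real m"
        using int_B by (simp add: prob_space)
      also have "(\<Sum>j<N. expectation (\<lambda>x. indicator (B m) ((T ^^ j) x))) = (\<Sum>j<N. prob (B m))"
      proof (rule sum.cong[OF refl])
        fix j
        have "expectation (\<lambda>x. indicator (B m) ((T ^^ j) x)) = expectation (indicator ((T ^^ j) -` B m \<inter> space M))"
          by (intro Bochner_Integration.integral_cong) (auto simp: indicator_def)
        also have "\<dots> = prob ((T ^^ j) -` B m \<inter> space M)"
          by simp
        finally show "expectation (\<lambda>x. indicator (B m) ((T ^^ j) x)) = prob (B m)"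
          by (simp add: pres)
      qed
      also have "expectation (\<lambda>x. F N x - \<beta> * real N) = expectation (F N) - \<beta> * real N"
        using int_F[OF N] by (simp add: prob_space)
      finally show ?thesis
        using mean[OF N] by (simp add: algebra_simps)
    qed
    then have *: "(\<gamma> - \<beta> - D * prob (B m)) * real N \<le> D * real m" if "N \<ge> 1" for N
      using that by (simp add: algebra_simps)
    obtain N :: nat where "N > D * real m / (\<gamma> - \<beta> - D * prob (B m))"
      using reals_Archimedean2 by blast
    then have "real N * (\<gamma> - \<beta> - D * prob (B m)) > D * real m"
      using m by (simp add: divide_less_eq)
    moreover have "N \<ge> 1"
      using calculation mult_nonneg_nonneg[OF D, of "real m"] by (cases N) auto
    ultimately show False
      using *[of N] by (simp add: mult.commute)
  qed
  then have "AE x in M. x \<notin> A"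
    using A by (intro AE_not_in) (simp add: null_sets_def emeasure_eq_measure)
  then show ?thesis
    using AE_space
  proof eventually_elim
    case (elim x)
    then have "L x > ereal \<gamma>'"
      using \<beta> by (auto simp: A_def not_less intro: less_le_trans[of _ "ereal \<beta>"])
    then have "\<forall>\<^sub>F n in sequentially. ereal (F n x / real n) > ereal \<gamma>'"
      unfolding L_def by (rule less_LiminfD)
    then show ?case
      using eventually_gt_at_top[of 0]
      by eventually_elim (simp add: field_simps)
  qed
qed

section \<open>Words\<close>

abbreviation words :: "nat \<Rightarrow> 'a list set" where
  "words n \<equiv> {a. length a = n}"

lemma finite_words [simp]: "finite (words n :: 'a::finite list set)"
  using finite_lists_length_eq[of "UNIV::'a set" n] by simp

lemma sum_words_append:
  fixes f :: "'a::finite list \<Rightarrow> 'b::comm_monoid_add"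
  shows "(\<Sum>a\<in>words (m + n). f a) = (\<Sum>u\<in>words m. \<Sum>v\<in>words n. f (u @ v))"
proof -
  have "(\<Sum>u\<in>words m. \<Sum>v\<in>words n. f (u @ v)) = (\<Sum>(u, v)\<in>words m \<times> words n. f (u @ v))"
    by (simp add: sum.cartesian_product)
  also have "\<dots> = (\<Sum>a\<in>words (m + n). f a)"
    by (rule sum.reindex_bij_witness[where i="\<lambda>a. (take m a, drop m a)" and j="\<lambda>(u,v). u @ v"]) auto
  finally show ?thesis ..
qed

lemma sum_words_0 [simp]: "(\<Sum>a\<in>words 0. f a) = f []"
  by simp

lemma sum_words_1:
  fixes f :: "'a::finite list \<Rightarrow> 'b::comm_monoid_add"
  shows "(\<Sum>a\<in>words (Suc 0). f a) = (\<Sum>a\<in>UNIV. f [a])"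
  by (rule sum.reindex_bij_witness[where i="\<lambda>a. [a]" and j=hd]) (auto simp: length_Suc_conv)

lemma sum_words_Suc:
  fixes f :: "'a::finite list \<Rightarrow> 'b::comm_monoid_add"
  shows "(\<Sum>a\<in>words (Suc n). f a) = (\<Sum>a\<in>UNIV. \<Sum>v\<in>words n. f (a # v))"
  using sum_words_append[of f "Suc 0" n] by (simp add: sum_words_1)

lemma sum_words_Suc_snoc:
  fixes f :: "'a::finite list \<Rightarrow> 'b::comm_monoid_add"
  shows "(\<Sum>a\<in>words (Suc n). f a) = (\<Sum>v\<in>words n. \<Sum>a\<in>UNIV. f (v @ [a]))"
  using sum_words_append[of f n "Suc 0"] by (simp add: sum_words_1)

lemma sum_pos_imp_ex_pos:
  fixes f :: "'b \<Rightarrow> real"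
  shows "(\<Sum>x\<in>A. f x) > 0 \<Longrightarrow> \<exists>x\<in>A. f x > 0"
  using sum_nonpos[of A f] by (force simp: not_less)

section \<open>Emission probabilities\<close>

text \<open>The product of the matrices \<open>diag R\<^bsub>\<cdot>,a\<^esub> T\<close> over the letters \<open>a\<close> of the word, applied to the
  column vector \<open>g\<close>; for \<open>g = 1\<close> it is the probability of emitting the word from hidden state \<open>s\<close>.\<close>

primrec emit :: "real ^ 's ^ 's \<Rightarrow> real ^ 'a ^ 's \<Rightarrow> ('s \<Rightarrow> real) \<Rightarrow> 'a list \<Rightarrow> 's \<Rightarrow> real" where
  "emit T R g [] s = g s"
| "emit T R g (a # w) s = R $ s $ a * (\<Sum>t\<in>UNIV. T $ s $ t * emit T R g w t)"

lemma emit_append: "emit T R g (u @ v) s = emit T R (emit T R g v) u s"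
  by (induction u arbitrary: s) auto

lemma emit_cmult: "emit T R (\<lambda>t. c * g t) u s = c * emit T R g u s"
  by (induction u arbitrary: s) (auto simp: algebra_simps sum_distrib_left)

lemma emit_sum: "emit T R (\<lambda>t. \<Sum>i\<in>I. g i t) u s = (\<Sum>i\<in>I. emit T R (g i) u s)"
proof (induction u arbitrary: s)
  case (Cons a u)
  have "(\<Sum>t\<in>UNIV. T $ s $ t * (\<Sum>i\<in>I. emit T R (g i) u t))
      = (\<Sum>i\<in>I. \<Sum>t\<in>UNIV. T $ s $ t * emit T R (g i) u t)"
    by (subst sum.swap) (simp add: sum_distrib_left)
  then show ?case
    by (simp add: Cons sum_distrib_left)
qed auto

lemma emit_mono:
  assumes "stochastic_matrix T" "stochastic_matrix R" "\<And>t. g t \<le> g' t"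
  shows "emit T R g u s \<le> emit T R g' u s"
  using assms
  by (induction u arbitrary: s)
    (auto simp: stochastic_matrix_def intro!: mult_left_mono sum_mono)

text \<open>The start vector g is arbitrary because splitting off the first hidden state s replaces
  the initial distribution by the row of \<open>T\<close> at s.\<close>

lemma sum_paths_eq_emit:
  assumes "stochastic_matrix T"
  shows "(\<Sum>s\<in>words (Suc (length w)). g (s ! 0) * R $ (s ! 0) $ ((a # w) ! 0) *
             (\<Prod>k<length w. T $ (s ! k) $ (s ! Suc k) * R $ (s ! Suc k) $ ((a # w) ! Suc k)))
       = (\<Sum>s\<in>UNIV. g s * emit T R (\<lambda>_. 1) (a # w) (s::'s::finite))"
proof (induction w arbitrary: a g)
  case Nil
  then show ?case
    using assms by (simp add: sum_words_1 stochastic_matrix_def)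
next
  case (Cons b w)
  have "(\<Sum>s\<in>words (Suc (length (b # w))). g (s ! 0) * R $ (s ! 0) $ ((a # b # w) ! 0) *
           (\<Prod>k<length (b # w). T $ (s ! k) $ (s ! Suc k) * R $ (s ! Suc k) $ ((a # b # w) ! Suc k)))
      = (\<Sum>s\<in>UNIV. g s * R $ s $ a * (\<Sum>v\<in>words (Suc (length w)). T $ s $ (v ! 0) * R $ (v ! 0) $ ((b # w) ! 0) *
           (\<Prod>k<length w. T $ (v ! k) $ (v ! Suc k) * R $ (v ! Suc k) $ ((b # w) ! Suc k))))"
    by (subst sum_words_Suc) (simp add: prod.lessThan_Suc_shift sum_distrib_left mult.assoc del: prod.lessThan_Suc)
  also have "\<dots> = (\<Sum>s\<in>UNIV. g s * R $ s $ a * (\<Sum>t\<in>UNIV. T $ s $ t * emit T R (\<lambda>_. 1) (b # w) t))"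
    by (subst Cons) simp
  finally show ?case
    by (simp add: mult.assoc)
qed

lemma sum_emit_letter:
  assumes "stochastic_matrix R"
  shows "(\<Sum>a\<in>UNIV. emit T R g (a # w) s) = (\<Sum>t\<in>UNIV. T $ s $ t * emit T R g w t)"
  using assms by (simp add: stochastic_matrix_def flip: sum_distrib_right)

text \<open>Summing over a letter removes \<open>R\<close>, whose rows sum to 1, and leaves one
  factor \<open>T\<close>. The induction takes letters from the end, which changes the vector g;
  hence g is arbitrary.\<close>

lemma sum_emit_words:
  assumes "stochastic_matrix R"
  shows "(\<Sum>u\<in>words n. emit T R g u s) = (\<Sum>t\<in>UNIV. matrix_power T n $ s $ t * g t)"
proof (induction n arbitrary: g)
  case 0
  have "(\<Sum>t\<in>UNIV. mat 1 $ s $ t * g t) = (\<Sum>t\<in>UNIV. if t = s then g t else 0)"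
    by (rule sum.cong) (auto simp: mat_def)
  then show ?case
    by (simp add: matrix_power_def)
next
  case (Suc n)
  have "(\<Sum>u\<in>words (Suc n). emit T R g u s) = (\<Sum>v\<in>words n. emit T R (\<lambda>t. \<Sum>a\<in>UNIV. emit T R g [a] t) v s)"
    by (simp add: sum_words_Suc_snoc emit_append emit_sum del: emit.simps)
  also have "\<dots> = (\<Sum>v\<in>words n. emit T R (\<lambda>t. \<Sum>r\<in>UNIV. T $ t $ r * g r) v s)"
    using sum_emit_letter[OF assms, of T g "[]"] by simp
  also have "\<dots> = (\<Sum>t\<in>UNIV. matrix_power T n $ s $ t * (\<Sum>r\<in>UNIV. T $ t $ r * g r))"
    by (rule Suc)
  also have "\<dots> = (\<Sum>r\<in>UNIV. (\<Sum>t\<in>UNIV. matrix_power T n $ s $ t * T $ t $ r) * g r)"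
    by (subst sum_distrib_right, subst sum.swap) (simp add: sum_distrib_left mult.assoc)
  also have "\<dots> = (\<Sum>t\<in>UNIV. matrix_power T (Suc n) $ s $ t * g t)"
    by (simp add: matrix_power_def matrix_matrix_mult_def)
  finally show ?case .
qed

section \<open>Irreducible hidden-Markov measures\<close>

locale hidden_markov =
  fixes P :: "(nat \<Rightarrow> 'a::finite) measure" and p :: "real ^ 's::finite"
    and T :: "real ^ 's ^ 's" and R :: "real ^ 'a ^ 's"
  assumes rep: "hidden_markov_rep P p T R" and irr: "irreducible_matrix T"
begin

lemma prob_space_P: "prob_space P" and sets_P: "sets P = sets sequence_algebra"
  and stoch_T: "stochastic_matrix T" and stoch_R: "stochastic_matrix R"
  and p_nonneg: "p $ s \<ge> 0" and sum_p: "(\<Sum>s\<in>UNIV. p $ s) = 1" and p_T: "p = p v* T"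
  using rep by (auto simp: hidden_markov_rep_def stationary_markov_chain_def)

sublocale prob_space P
  by (rule prob_space_P)

lemma space_P [simp]: "space P = UNIV"
  using sets_eq_imp_space_eq[OF sets_P] by (simp add: sequence_algebra_def space_PiM)

abbreviation em :: "'a list \<Rightarrow> 's \<Rightarrow> real" where
  "em \<equiv> emit T R (\<lambda>_. 1)"

lemma T_nonneg: "T $ s $ t \<ge> 0" and R_nonneg: "R $ s $ a \<ge> 0" and sum_T: "(\<Sum>t\<in>UNIV. T $ s $ t) = 1"
  and sum_R: "(\<Sum>a\<in>UNIV. R $ s $ a) = 1"
  using stoch_T stoch_R by (auto simp: stochastic_matrix_def)

lemma word_prob_eq_emit: "word_prob P w = (\<Sum>s\<in>UNIV. p $ s * em w s)"
proof (cases w)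
  case Nil
  have "cylinder [] = space P"
    by (auto simp: cylinder_def initial_word_def)
  with Nil show ?thesis
    by (simp add: word_prob_def prob_space sum_p del: space_P)
next
  case (Cons a v)
  have *: "\<forall>n\<ge>1. \<forall>a. length a = n \<longrightarrow> word_prob P a =
          (\<Sum>s | length s = n.
             p $ (s ! 0) * R $ (s ! 0) $ (a ! 0) *
             (\<Prod>k<n - 1. T $ (s ! k) $ (s ! Suc k) * R $ (s ! Suc k) $ (a ! Suc k)))"
    using rep unfolding hidden_markov_rep_def by (elim conjE)
  have "word_prob P w =
          (\<Sum>s | length s = Suc (length v).
             p $ (s ! 0) * R $ (s ! 0) $ (w ! 0) *
             (\<Prod>k<Suc (length v) - 1. T $ (s ! k) $ (s ! Suc k) * R $ (s ! Suc k) $ (w ! Suc k)))"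
    by (rule *[rule_format]) (simp_all add: Cons)
  also have "\<dots> = (\<Sum>s\<in>UNIV. p $ s * em w s)"
    using sum_paths_eq_emit[OF stoch_T, where g="\<lambda>s. p $ s" and R=R and a=a and w=v] Cons by simp
  finally show ?thesis .
qed

lemma em_nonneg: "em w s \<ge> 0"
  using emit_mono[OF stoch_T stoch_R, of "\<lambda>_. 0" "\<lambda>_. 1" w s] emit_cmult[of T R 0 "\<lambda>_. 1" w s] by simp

lemma sum_em_words: "(\<Sum>u\<in>words n. em u s) = 1"
proof (induction n)
  case (Suc n)
  have "(\<Sum>u\<in>words (Suc n). em u s) = (\<Sum>u\<in>words n. emit T R (\<lambda>t. \<Sum>a\<in>UNIV. em [a] t) u s)"
    by (simp add: sum_words_Suc_snoc emit_append emit_sum del: emit.simps)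
  also have "(\<lambda>t. \<Sum>a\<in>UNIV. em [a] t) = (\<lambda>_. 1)"
    using sum_emit_letter[OF stoch_R, of T "\<lambda>_. 1" "[]"] by (simp add: sum_T)
  finally show ?case
    using Suc by simp
qed simp

lemma p_matrix_power: "(\<Sum>s\<in>UNIV. p $ s * matrix_power T n $ s $ t) = p $ t"
proof (induction n arbitrary: t)
  case 0
  have "(\<Sum>s\<in>UNIV. p $ s * mat 1 $ s $ t) = (\<Sum>s\<in>UNIV. if s = t then p $ s else 0)"
    by (rule sum.cong) (auto simp: mat_def)
  then show ?case
    by (simp add: matrix_power_def)
next
  case (Suc n)
  have "(\<Sum>s\<in>UNIV. p $ s * matrix_power T (Suc n) $ s $ t)
     = (\<Sum>s\<in>UNIV. \<Sum>r\<in>UNIV. p $ s * matrix_power T n $ s $ r * T $ r $ t)"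
    by (simp add: matrix_power_def matrix_matrix_mult_def sum_distrib_left mult.assoc)
  also have "\<dots> = (\<Sum>r\<in>UNIV. (\<Sum>s\<in>UNIV. p $ s * matrix_power T n $ s $ r) * T $ r $ t)"
    by (subst sum.swap) (simp add: sum_distrib_right)
  also have "\<dots> = (p v* T) $ t"
    by (simp add: Suc vector_matrix_mult_def mult.commute)
  finally show ?case
    using p_T by simp
qed

lemma matrix_power_nonneg: "matrix_power T n $ s $ t \<ge> 0"
proof (induction n arbitrary: t)
  case (Suc n)
  have "matrix_power T (Suc n) $ s $ t = (\<Sum>r\<in>UNIV. matrix_power T n $ s $ r * T $ r $ t)"
    by (simp add: matrix_power_def matrix_matrix_mult_def)
  then show ?case
    using Suc by (simp add: sum_nonneg T_nonneg)
qed (simp add: matrix_power_def mat_def)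

text \<open>Invariance under all powers of \<open>T\<close> carries the mass of one charged state to
  every other state.\<close>

lemma p_pos: "p $ t > 0"
proof -
  obtain s where s: "p $ s > 0"
    using sum_p sum_pos_imp_ex_pos[where A=UNIV and f="\<lambda>s. p $ s"] by auto
  obtain n where n: "matrix_power T n $ s $ t > 0"
    using irr by (auto simp: irreducible_matrix_def)
  have "0 < p $ s * matrix_power T n $ s $ t"
    using s n by simp
  also have "\<dots> \<le> (\<Sum>s\<in>UNIV. p $ s * matrix_power T n $ s $ t)"
    by (rule member_le_sum) (auto simp: p_nonneg matrix_power_nonneg)
  finally show ?thesis
    by (simp add: p_matrix_power)
qed

lemma word_prob_nonneg: "word_prob P w \<ge> 0" and word_prob_le_1: "word_prob P w \<le> 1"
  by (simp_all add: word_prob_def)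

lemma word_prob_Nil: "word_prob P [] = 1"
  by (simp add: word_prob_eq_emit sum_p)

text \<open>Here stationarity enters: summing out the first letter advances the initial distribution
  by one step of the chain. It is the shift invariance of the measure at the level of words.\<close>

lemma sum_word_prob_Cons: "(\<Sum>a\<in>UNIV. word_prob P (a # w)) = word_prob P w"
proof -
  have "(\<Sum>a\<in>UNIV. word_prob P (a # w)) = (\<Sum>s\<in>UNIV. p $ s * (\<Sum>a\<in>UNIV. em (a # w) s))"
    by (subst sum_distrib_left, subst sum.swap) (simp only: word_prob_eq_emit)
  also have "\<dots> = (\<Sum>s\<in>UNIV. p $ s * (\<Sum>t\<in>UNIV. T $ s $ t * em w t))"
    by (simp only: sum_emit_letter[OF stoch_R])
  also have "\<dots> = (\<Sum>t\<in>UNIV. (p v* T) $ t * em w t)"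
    by (simp add: vector_matrix_mult_def sum_distrib_left sum_distrib_right ac_simps) (rule sum.swap)
  finally show ?thesis
    using p_T by (simp add: word_prob_eq_emit)
qed

lemma sum_word_prob_append_left: "(\<Sum>u\<in>words n. word_prob P (u @ w)) = word_prob P w"
proof (induction n)
  case (Suc n)
  have "(\<Sum>u\<in>words (Suc n). word_prob P (u @ w)) = (\<Sum>v\<in>words n. \<Sum>a\<in>UNIV. word_prob P (a # v @ w))"
    by (subst sum_words_Suc, subst sum.swap) simp
  then show ?case
    using Suc by (simp add: sum_word_prob_Cons)
qed simp

section \<open>Decoupling, recurrence and the probability of avoiding a word\<close>

lemma word_prob_append_le_right: "word_prob P (u @ w) \<le> word_prob P w"
  using member_le_sum[of u "words (length u)" "\<lambda>u. word_prob P (u @ w)"] word_prob_nonneg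
  by (simp add: sum_word_prob_append_left)

text \<open>The constant C of the decoupling inequality. The state s alone contributes
  \<open>p $ s * em w s\<close> to the probability of w, so no state emits w with more than 1 / p_s
  times that probability.\<close>

definition dec :: real where
  "dec = 1 / Min (range (\<lambda>s. p $ s))"

lemma dec_ge: "1 / p $ s \<le> dec"
  using p_pos by (auto simp: dec_def intro!: divide_left_mono mult_pos_pos)

lemma dec_ge_1: "dec \<ge> 1"
proof -
  fix s
  have "p $ s \<le> 1"
    using member_le_sum[of s UNIV "\<lambda>s. p $ s"] p_nonneg sum_p by simp
  then show ?thesis
    using dec_ge[of s] p_pos[of s] by (smt (verit) le_divide_eq_1)
qed

lemma em_le_word_prob: "em w s \<le> dec * word_prob P w"
proof -
  have "p $ s * em w s \<le> word_prob P w"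
    unfolding word_prob_eq_emit
    by (rule member_le_sum) (auto simp: p_nonneg em_nonneg)
  then have "em w s \<le> 1 / p $ s * word_prob P w"
    using p_pos[of s] by (simp add: field_simps)
  also have "\<dots> \<le> dec * word_prob P w"
    by (intro mult_right_mono dec_ge word_prob_nonneg)
  finally show ?thesis .
qed

text \<open>Whatever the hidden state after u, it emits v with probability at most
  \<open>dec * word_prob P v\<close>; this constant can be pulled out of the matrix product of
  u.\<close>

lemma word_prob_append_le: "word_prob P (u @ v) \<le> dec * word_prob P u * word_prob P v"
proof -
  have "em (u @ v) s \<le> dec * word_prob P v * em u s" for s
  proof -
    have "em (u @ v) s \<le> emit T R (\<lambda>t. (dec * word_prob P v) * 1) u s"
      unfolding emit_append by (rule emit_mono[OF stoch_T stoch_R]) (simp add: em_le_word_prob)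
    then show ?thesis
      unfolding emit_cmult .
  qed
  then have "(\<Sum>s\<in>UNIV. p $ s * em (u @ v) s) \<le> (\<Sum>s\<in>UNIV. p $ s * (dec * word_prob P v * em u s))"
    by (intro sum_mono mult_left_mono p_nonneg)
  also have "\<dots> = dec * word_prob P u * word_prob P v"
    by (simp add: word_prob_eq_emit sum_distrib_left sum_distrib_right ac_simps)
  finally show ?thesis
    unfolding word_prob_eq_emit .
qed

text \<open>A positive sum over hidden paths has a positive term, a product with one factor R T per
  letter, and such factors take only finitely many positive values. The use is that information
  content grows at most linearly in the length.\<close>

lemma word_prob_lower_bound:
  "\<exists>\<eta>>0. \<eta> \<le> 1 \<and> (\<forall>w. word_prob P w > 0 \<longrightarrow> word_prob P w \<ge> \<eta> ^ length w)"
proof -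
  define E where "E = {e. e > 0 \<and> (\<exists>s a t. e = R $ s $ a * T $ s $ t)}"
  define m where "m = Min (insert 1 E)"
  have "E \<subseteq> range (\<lambda>(s, a, t). R $ s $ a * T $ s $ t)"
    unfolding E_def by (clarsimp simp: image_iff) blast
  then have fin: "finite E"
    by (rule finite_subset) simp
  have m: "m > 0" "m \<le> 1"
    using fin by (auto simp: m_def E_def)
  have m_le: "m \<le> R $ s $ a * T $ s $ t" if "R $ s $ a * T $ s $ t > 0" for s a t
  proof -
    have "R $ s $ a * T $ s $ t \<in> E"
      using that unfolding E_def by blast
    then show ?thesis
      using fin by (simp add: m_def)
  qed
  have em: "em w s > 0 \<Longrightarrow> em w s \<ge> m ^ length w" for w s
  proof (induction w arbitrary: s)
    case (Cons a w)
    have eq: "em (a # w) s = (\<Sum>t\<in>UNIV. R $ s $ a * T $ s $ t * em w t)"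
      by (simp add: sum_distrib_left mult.assoc)
    obtain t where t: "R $ s $ a * T $ s $ t * em w t > 0"
      using Cons.prems unfolding eq by (blast dest: sum_pos_imp_ex_pos)
    then have pos: "R $ s $ a * T $ s $ t > 0" "em w t > 0"
      using em_nonneg[of w t] by (auto simp: zero_less_mult_iff)
    have "m ^ length (a # w) \<le> R $ s $ a * T $ s $ t * em w t"
      using mult_mono[OF m_le[OF pos(1)] Cons.IH[OF pos(2)]] pos m(1) by simp
    also have "\<dots> \<le> em (a # w) s"
      unfolding eq by (rule member_le_sum) (auto simp: R_nonneg T_nonneg em_nonneg)
    finally show ?case .
  qed simp
  \<comment> \<open>Only one factor \<open>dec\<close> is lost in passing from a state to the
    measure; charging it to every letter keeps the bound of the form
    \<open>\<eta> ^ length w\<close>.\<close>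
  define \<eta> where "\<eta> = m / dec"
  have "\<eta> > 0" "\<eta> \<le> 1"
    using m dec_ge_1 by (auto simp: \<eta>_def divide_le_eq)
  moreover have "word_prob P w \<ge> \<eta> ^ length w" if pos: "word_prob P w > 0" for w
  proof (cases "w = []")
    case False
    obtain s where s: "p $ s * em w s > 0"
      using pos unfolding word_prob_eq_emit by (blast dest: sum_pos_imp_ex_pos)
    then have "em w s > 0"
      using p_pos[of s] by (simp add: zero_less_mult_iff)
    then have "m ^ length w \<le> em w s"
      by (rule em)
    also have "\<dots> \<le> dec * word_prob P w"
      by (rule em_le_word_prob)
    also have "\<dots> \<le> dec ^ length w * word_prob P w"
      using dec_ge_1 False power_increasing[of 1 "length w" dec]
      by (intro mult_right_mono word_prob_nonneg) (cases w, auto)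
    finally show ?thesis
      using dec_ge_1 by (simp add: \<eta>_def power_divide divide_le_eq mult.commute)
  qed (simp add: word_prob_Nil)
  ultimately show ?thesis by blast
qed

text \<open>As \<open>word_prob P w\<close> is a p-average of emission probabilities, some state t
  emits w with at least that probability, and t is reached from s in a number of steps taken from a
  finite table. The gap j depends on w and s; for a periodic chain no single gap would serve all of
  them.\<close>

lemma recurrence_emit:
  "\<exists>\<tau> c. c > 0 \<and> c \<le> 1 \<and> (\<forall>w s. \<exists>j\<le>\<tau>. (\<Sum>u\<in>words j. em (u @ w) s) \<ge> c * word_prob P w)"
proof -
  obtain n where n: "\<And>s t. matrix_power T (n s t) $ s $ t > 0"
    using irr unfolding irreducible_matrix_def by metis
  define \<tau> where "\<tau> = Max (range (\<lambda>(s, t). n s t))"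
  define c where "c = Min (insert 1 (range (\<lambda>(s, t). matrix_power T (n s t) $ s $ t)))"
  have le\<tau>: "n s t \<le> \<tau>" for s t
    unfolding \<tau>_def by (rule Max_ge) (auto simp: image_iff)
  have c: "c > 0" "c \<le> 1"
    using n by (auto simp: c_def)
  have cle: "c \<le> matrix_power T (n s t) $ s $ t" for s t
    unfolding c_def by (rule Min_le) (auto simp: image_iff)
  have "\<exists>j\<le>\<tau>. (\<Sum>u\<in>words j. em (u @ w) s) \<ge> c * word_prob P w" for w s
  proof -
    obtain t where t: "em w t \<ge> word_prob P w"
    proof (rule ccontr)
      assume "\<not> thesis"
      then have "em w t < word_prob P w" for t
        using that by (meson linorder_not_le)
      then have "(\<Sum>t\<in>UNIV. p $ t * em w t) < (\<Sum>t\<in>UNIV. p $ t * word_prob P w)"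
        by (intro sum_strict_mono mult_strict_left_mono p_pos) auto
      then show False
        by (simp add: sum_p word_prob_eq_emit flip: sum_distrib_right)
    qed
    have "c * word_prob P w \<le> matrix_power T (n s t) $ s $ t * em w t"
      using t cle c by (intro mult_mono) (auto simp: word_prob_nonneg matrix_power_nonneg)
    also have "\<dots> \<le> (\<Sum>t'\<in>UNIV. matrix_power T (n s t) $ s $ t' * em w t')"
      by (rule member_le_sum) (auto simp: em_nonneg matrix_power_nonneg)
    also have "\<dots> = (\<Sum>u\<in>words (n s t). em (u @ w) s)"
      by (simp add: emit_append sum_emit_words[OF stoch_R])
    finally show ?thesis
      using le\<tau> by blast
  qed
  then show ?thesis
    using c by blast
qed

text \<open>A block of length \<tau> + |w| has room for a gap and a copy of w, so from any hidden
  state it contains w with probability at least \<open>c * word_prob P w\<close>. Uniformity in the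
  starting state lets the bounds for the m blocks be multiplied without independence.\<close>

lemma sum_avoid_le:
  fixes w :: "'a list"
  assumes c: "0 < c" "c \<le> 1"
    and rec: "\<forall>w s. \<exists>j\<le>\<tau>. (\<Sum>u\<in>words j. em (u @ w) s) \<ge> c * word_prob P w"
  shows "(\<Sum>u\<in>{u\<in>words (m * (\<tau> + length w)). \<not> sublist w u}. em u s) \<le> (1 - c * word_prob P w) ^ m"
proof (induction m)
  case (Suc m)
  define L where "L = \<tau> + length w"
  define A where "A n = {u\<in>words n. \<not> sublist w u}" for n
  define \<rho> where "\<rho> = 1 - c * word_prob P w"
  have finA: "finite (A n)" for n
    unfolding A_def by simp
  have \<rho>0: "\<rho> \<ge> 0"
    using c word_prob_le_1[of w] word_prob_nonneg[of w] by (simp add: \<rho>_def mult_le_one)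
  have block: "(\<Sum>u\<in>A L. em u t) \<le> \<rho>" for t
  proof -
    obtain j where j: "j \<le> \<tau>" "(\<Sum>u\<in>words j. em (u @ w) t) \<ge> c * word_prob P w"
      using rec by blast
    \<comment> \<open>Free letters after w bring all blocks to the same length, whatever the
      gap.\<close>
    define k where "k = \<tau> - j"
    have L: "L = j + (length w + k)"
      using j by (simp add: L_def k_def)
    have "(\<Sum>u\<in>words j. em (u @ w) t) = (\<Sum>u\<in>words j. \<Sum>v\<in>words k. em (u @ w @ v) t)"
    proof (rule sum.cong[OF refl])
      fix u
      have "(\<Sum>v\<in>words k. em (u @ w @ v) t) = emit T R (\<lambda>s. \<Sum>v\<in>words k. em v s) (u @ w) t"
        by (simp add: emit_sum flip: emit_append)
      then show "em (u @ w) t = (\<Sum>v\<in>words k. em (u @ w @ v) t)"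
        by (simp add: sum_em_words)
    qed
    also have "\<dots> = (\<Sum>(u, v)\<in>words j \<times> words k. em (u @ w @ v) t)"
      by (simp add: sum.cartesian_product)
    also have "\<dots> = (\<Sum>a\<in>(\<lambda>(u, v). u @ w @ v) ` (words j \<times> words k). em a t)"
      by (subst sum.reindex) (auto simp: inj_on_def case_prod_unfold)
    also have "\<dots> \<le> (\<Sum>a\<in>words L - A L. em a t)"
      by (rule sum_mono2) (auto simp: em_nonneg A_def L)
    also have "\<dots> = 1 - (\<Sum>u\<in>A L. em u t)"
      by (subst sum_diff) (auto simp: sum_em_words A_def)
    finally show ?thesis
      using j by (simp add: \<rho>_def)
  qed
  have "(\<Sum>u\<in>A (m * L + L). em u s) \<le> (\<Sum>a\<in>(\<lambda>(u, v). u @ v) ` (A (m * L) \<times> A L). em a s)"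
  proof (rule sum_mono2)
    show "A (m * L + L) \<subseteq> (\<lambda>(u, v). u @ v) ` (A (m * L) \<times> A L)"
    proof
      fix a assume a: "a \<in> A (m * L + L)"
      have "\<not> sublist w (take (m * L) a)" "\<not> sublist w (drop (m * L) a)"
        using a sublist_order.order.trans[of w _ a] by (auto simp: A_def)
      with a show "a \<in> (\<lambda>(u, v). u @ v) ` (A (m * L) \<times> A L)"
        by (intro image_eqI[of _ _ "(take (m * L) a, drop (m * L) a)"]) (auto simp: A_def)
    qed
  qed (auto simp: finA em_nonneg)
  also have "\<dots> = (\<Sum>(u, v)\<in>A (m * L) \<times> A L. em (u @ v) s)"
    by (subst sum.reindex) (auto simp: inj_on_def A_def case_prod_unfold)
  also have "\<dots> = (\<Sum>u\<in>A (m * L). emit T R (\<lambda>t. \<Sum>v\<in>A L. em v t) u s)"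
    by (simp add: sum.cartesian_product[symmetric] emit_append emit_sum)
  also have "\<dots> \<le> (\<Sum>u\<in>A (m * L). emit T R (\<lambda>t. \<rho> * 1) u s)"
    by (intro sum_mono emit_mono stoch_T stoch_R) (simp add: block)
  also have "\<dots> = \<rho> * (\<Sum>u\<in>A (m * L). em u s)"
    unfolding emit_cmult by (simp add: sum_distrib_left)
  also have "\<dots> \<le> \<rho> * \<rho> ^ m"
    using Suc \<rho>0 by (intro mult_left_mono) (auto simp: A_def L_def \<rho>_def)
  finally show ?case
    by (simp add: A_def L_def \<rho>_def add.commute)
next
  case 0
  have "(\<Sum>u\<in>{u\<in>words 0. \<not> sublist w u}. em u s) \<le> (\<Sum>u\<in>words 0. em u s)"
    by (rule sum_mono2) (auto simp: em_nonneg)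
  then show ?case
    by simp
qed

end

section \<open>The shift\<close>

definition shift :: "(nat \<Rightarrow> 'a) \<Rightarrow> nat \<Rightarrow> 'a" where
  "shift y = (\<lambda>n. y (Suc n))"

lemma funpow_shift: "(shift ^^ m) y = (\<lambda>n. y (n + m))"
  by (induction m) (auto simp: shift_def)

lemma length_initial_word [simp]: "length (initial_word n x) = n"
  by (simp add: initial_word_def)

lemma take_initial_word: "m \<le> n \<Longrightarrow> take m (initial_word n x) = initial_word m x"
  by (simp add: initial_word_def take_map)

lemma initial_word_add: "initial_word (m + n) x = initial_word m x @ initial_word n ((shift ^^ m) x)"
  by (rule nth_equalityI) (auto simp: initial_word_def nth_append funpow_shift)

lemma drop_initial_word: "drop m (initial_word (m + n) x) = initial_word n ((shift ^^ m) x)"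
  by (simp add: initial_word_add)

lemma initial_word_Suc: "initial_word (Suc n) x = x 0 # initial_word n (shift x)"
  by (rule nth_equalityI) (auto simp: initial_word_def shift_def nth_Cons simp del: upt_Suc split: nat.split)

lemma space_sequence_algebra: "space sequence_algebra = UNIV"
  by (simp add: sequence_algebra_def space_PiM)

lemma UNIV_in_sets_sequence_algebra [simp]: "UNIV \<in> sets sequence_algebra"
  by (metis sets.top space_sequence_algebra)

lemma measurable_initial_word [measurable]:
  "initial_word n \<in> measurable (sequence_algebra :: (nat \<Rightarrow> 'a::finite) measure) (count_space UNIV)"
proof -
  have "{x :: nat \<Rightarrow> 'a. initial_word n x = a} \<in> sets sequence_algebra" for a
  proof (cases "length a = n")
    case True
    then have "{x. initial_word n x = a} = {x\<in>space sequence_algebra. \<forall>i\<in>{..<n}. x i = a ! i}"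
      by (auto simp: initial_word_def list_eq_iff_nth_eq space_sequence_algebra)
    also have "\<dots> \<in> sets sequence_algebra"
    proof (rule sets.sets_Collect_finite_All)
      fix i :: nat
      have "(\<lambda>x. x i) \<in> measurable (sequence_algebra :: (nat \<Rightarrow> 'a) measure) (count_space UNIV)"
        unfolding sequence_algebra_def by (rule measurable_component_singleton) simp
      then have "(\<lambda>x. x i) -` {a ! i} \<inter> space sequence_algebra \<in> sets (sequence_algebra :: (nat \<Rightarrow> 'a) measure)"
        by (rule measurable_sets) simp
      then show "{x\<in>space sequence_algebra. x i = a ! i} \<in> sets (sequence_algebra :: (nat \<Rightarrow> 'a) measure)"
        by (simp add: vimage_def Int_def conj_commute)
    qed simp
    finally show ?thesis .
  next
    case False
    then have "{x. initial_word n x = a} = {}"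
      by auto
    then show ?thesis
      by simp
  qed
  then show ?thesis
    by (subst measurable_count_space_eq2_countable)
      (auto simp: vimage_def space_sequence_algebra)
qed

lemma measurable_shift [measurable]: "shift \<in> measurable sequence_algebra sequence_algebra"
  unfolding sequence_algebra_def shift_def by (rule measurable_PiM_single') (auto simp: space_PiM)

lemma measurable_funpow_shift [measurable]:
  "(shift ^^ m) \<in> measurable sequence_algebra sequence_algebra"
  by (induction m) (auto intro!: measurable_comp[OF _ measurable_shift])

definition word_event :: "nat \<Rightarrow> 'a list set \<Rightarrow> (nat \<Rightarrow> 'a) set" where
  "word_event n W = {x. initial_word n x \<in> W}"

lemma cylinder_eq_word_event: "cylinder w = word_event (length w) {w}"
  by (auto simp: cylinder_def word_event_def)

lemma sets_word_event [simp]: "word_event n W \<in> sets (sequence_algebra :: (nat \<Rightarrow> 'a::finite) measure)"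
  using measurable_sets[OF measurable_initial_word[of n], of W]
  by (simp add: word_event_def vimage_def space_sequence_algebra)

lemma sets_sequence_algebra_eq:
  "sets (sequence_algebra :: (nat \<Rightarrow> 'a::finite) measure) = sigma_sets UNIV (insert {} (range cylinder))"
proof
  let ?E = "insert {} (range cylinder) :: (nat \<Rightarrow> 'a) set set"
  show "sigma_sets UNIV ?E \<subseteq> sets sequence_algebra"
    unfolding space_sequence_algebra[symmetric]
    by (rule sets.sigma_sets_subset) (auto simp: cylinder_eq_word_event sets_word_event)
  have gen: "{f. f i \<in> A} \<in> sigma_sets UNIV ?E" for i and A :: "'a set"
  proof -
    have "{f. f i \<in> A} = (\<Union>w\<in>{w\<in>words (Suc i). w ! i \<in> A}. cylinder w)"
      by (auto simp: cylinder_def initial_word_def list_eq_iff_nth_eq nth_append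
            intro!: exI[of _ "map _ [0..<Suc i]"] simp del: upt_Suc)
    also have "\<dots> \<in> sigma_sets UNIV ?E"
    proof -
      interpret sigma_algebra UNIV "sigma_sets UNIV ?E"
        by (rule sigma_algebra_sigma_sets) simp
      show ?thesis
        by (rule finite_UN) (auto intro: sigma_sets.Basic)
    qed
    finally show ?thesis .
  qed
  have "sets (sequence_algebra :: (nat \<Rightarrow> 'a) measure)
      = sigma_sets UNIV {{f. f i \<in> A} | i A. True}"
    unfolding sequence_algebra_def by (subst sets_PiM_single) simp
  also have "\<dots> \<subseteq> sigma_sets UNIV ?E"
    by (rule sigma_sets_mono) (use gen in auto)
  finally show "sets (sequence_algebra :: (nat \<Rightarrow> 'a) measure) \<subseteq> sigma_sets UNIV ?E" .
qed

text \<open>Two cylinders are nested or disjoint; the empty set joins the generators for the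
  disjoint case.\<close>

lemma Int_stable_cylinders: "Int_stable (insert {} (range cylinder))"
proof -
  have le: "cylinder u \<inter> cylinder v \<in> {{}, cylinder v}" if "length u \<le> length v" for u v :: "'b list"
    using that by (auto simp: cylinder_def) (metis take_initial_word)+
  have "cylinder u \<inter> cylinder v \<in> insert {} (range cylinder)" for u v :: "'b list"
    using le[of u v] le[of v u] by (cases "length u \<le> length v") (auto simp: Int_commute)
  then show ?thesis
    by (auto simp: Int_stable_def)
qed

section \<open>Invariance, approximation by words and ergodicity\<close>

context hidden_markov
begin

lemma measurable_P [simp, measurable_cong]: "sets P = sets sequence_algebra"
  by (rule sets_P)

lemma sets_word_event_P [simp]: "word_event n W \<in> sets P"
  by (simp add: sets_word_event)

lemma prob_word_event:
  assumes "W \<subseteq> words n"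
  shows "prob (word_event n W) = (\<Sum>w\<in>W. word_prob P w)"
proof -
  have "finite W"
    using assms finite_words by (rule finite_subset)
  have "word_event n W = (\<Union>w\<in>W. cylinder w)"
    using assms by (auto simp: word_event_def cylinder_def)
  also have "prob \<dots> = (\<Sum>w\<in>W. prob (cylinder w))"
  proof (rule finite_measure_finite_Union[OF \<open>finite W\<close>])
    show "cylinder ` W \<subseteq> events"
      by (auto simp: cylinder_eq_word_event sets_word_event)
    show "disjoint_family_on cylinder W"
      unfolding disjoint_family_on_def
    proof (intro ballI impI)
      fix u v assume "u \<in> W" "v \<in> W" "u \<noteq> v"
      with assms have "length u = n" "length v = n"
        by auto
      with \<open>u \<noteq> v\<close> show "cylinder u \<inter> cylinder v = {}"
        by (auto simp: cylinder_def)
    qed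
  qed
  finally show ?thesis
    by (simp add: word_prob_def)
qed

lemma distr_shift: "distr P P shift = P"
proof (rule measure_eqI_generator_eq[where E="insert {} (range cylinder)" and \<Omega>=UNIV and A="\<lambda>_. UNIV"])
  show "Int_stable (insert {} (range cylinder))"
    by (rule Int_stable_cylinders)
  show "sets (distr P P shift) = sigma_sets UNIV (insert {} (range cylinder))"
    "sets P = sigma_sets UNIV (insert {} (range cylinder))"
    by (simp_all add: sets_sequence_algebra_eq)
  have "UNIV = cylinder []"
    by (auto simp: cylinder_def initial_word_def)
  then show "range (\<lambda>_. UNIV) \<subseteq> insert {} (range cylinder)"
    by auto
  show "emeasure (distr P P shift) UNIV \<noteq> \<infinity>"
    by (subst emeasure_distr) (auto simp: emeasure_eq_measure)
  fix X :: "(nat \<Rightarrow> 'a) set" assume X: "X \<in> insert {} (range cylinder)"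
  then consider "X = {}" | w where "X = cylinder w"
    by auto
  then show "emeasure (distr P P shift) X = emeasure P X"
  proof cases
    case 2
    have "prob (shift -` X) = prob (word_event (Suc (length w)) ((\<lambda>a. a # w) ` UNIV))"
      by (intro arg_cong[of _ _ prob]) (auto simp: 2 word_event_def cylinder_def initial_word_Suc)
    also have "\<dots> = (\<Sum>v\<in>(\<lambda>a. a # w) ` UNIV. word_prob P v)"
      by (rule prob_word_event) auto
    also have "\<dots> = word_prob P w"
      by (subst sum.reindex) (auto simp: inj_on_def sum_word_prob_Cons)
    finally show ?thesis
      by (subst emeasure_distr) (auto simp: 2 cylinder_eq_word_event emeasure_eq_measure word_prob_def sets_word_event)
  qed simp
qed simp_all

lemma distr_funpow_shift: "distr P P (shift ^^ m) = P"
proof (induction m)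
  case (Suc m)
  have "distr P P (shift ^^ Suc m) = distr (distr P P (shift ^^ m)) P shift"
    by (subst distr_distr) simp_all
  also have "\<dots> = P"
    by (simp only: Suc distr_shift)
  finally show ?case .
qed (simp add: id_def)

lemma prob_vimage_shift: "B \<in> sets P \<Longrightarrow> prob ((shift ^^ m) -` B) = prob B"
  using measure_distr[of "shift ^^ m" P P B] by (simp add: distr_funpow_shift)

lemma sets_vimage_shift:
  "B \<in> sets sequence_algebra \<Longrightarrow> (shift ^^ m) -` B \<in> sets sequence_algebra"
  using measurable_sets[OF measurable_funpow_shift[of m], of B] by (simp add: space_sequence_algebra)

lemma prob_shifted_word_event:
  assumes "W \<subseteq> words n"
  shows "prob {x. initial_word n ((shift ^^ m) x) \<in> W} = (\<Sum>w\<in>W. word_prob P w)"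
  using prob_vimage_shift[OF sets_word_event_P, of m n W] prob_word_event[OF assms]
  by (simp add: word_event_def vimage_def)

text \<open>Sets approximable through finitely many coordinates are closed under complement, with
  the same error, and under countable union, after cutting the union at a finite N.\<close>

lemma approximation_by_words:
  assumes "B \<in> sets P" and "\<epsilon> > 0"
  shows "\<exists>n W. W \<subseteq> words n \<and> prob ((B - word_event n W) \<union> (word_event n W - B)) < \<epsilon>"
proof -
  have "B \<in> sigma_sets UNIV (insert {} (range cylinder))"
    using assms by (simp flip: sets_sequence_algebra_eq)
  then show ?thesis
    using \<open>\<epsilon> > 0\<close>
  proof (induction arbitrary: \<epsilon>)
    case (Basic B)
    then consider "B = {}" | w where "B = cylinder w"
      by auto
    then show ?case
    proof cases
      case 1
      then show ?thesis
        using Basic by (intro exI[of _ 0] exI[of _ "{}"]) (auto simp: word_event_def)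
    next
      case 2
      then show ?thesis
        using Basic by (intro exI[of _ "length w"] exI[of _ "{w}"]) (auto simp: cylinder_eq_word_event)
    qed
  next
    case Empty
    then show ?case
      by (intro exI[of _ 0] exI[of _ "{}"]) (auto simp: word_event_def)
  next
    case (Compl B)
    then obtain n W where W: "W \<subseteq> words n" "prob ((B - word_event n W) \<union> (word_event n W - B)) < \<epsilon>"
      by blast
    have "(UNIV - B - word_event n (words n - W)) \<union> (word_event n (words n - W) - (UNIV - B))
        = (B - word_event n W) \<union> (word_event n W - B)"
      by (auto simp: word_event_def)
    with W show ?case
      by (intro exI[of _ n] exI[of _ "words n - W"]) auto
  next
    case (Union B)
    have meas: "B i \<in> sets P" for i
      using Union.hyps by (simp add: sets_sequence_algebra_eq)
    have "(\<lambda>N. prob (\<Union>i<N. B i)) \<longlonglongrightarrow> prob (\<Union>N. \<Union>i<N. B i)"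
      using meas by (intro finite_Lim_measure_incseq) (auto simp: incseq_def, metis lessThan_iff less_le_trans)
    moreover have "(\<Union>N. \<Union>i<N. B i) = (\<Union>i. B i)"
      by auto
    ultimately have "\<forall>\<^sub>F N in sequentially. prob (\<Union>i<N. B i) > prob (\<Union>i. B i) - \<epsilon> / 2"
      using Union.prems by (intro order_tendstoD) auto
    then obtain N where N: "prob (\<Union>i<N. B i) > prob (\<Union>i. B i) - \<epsilon> / 2"
      by (auto simp: eventually_sequentially)
    \<comment> \<open>Half of \<epsilon> pays for the tail of the union and the rest is shared among
      the N sets; the added 1 avoids division by zero for N = 0.\<close>
    have "\<forall>i. \<exists>n W. W \<subseteq> words n \<and> prob ((B i - word_event n W) \<union> (word_event n W - B i)) < \<epsilon> / (2 * (real N + 1))"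
      using Union by simp
    then obtain n W where W: "\<And>i. W i \<subseteq> words (n i)"
      "\<And>i. prob ((B i - word_event (n i) (W i)) \<union> (word_event (n i) (W i) - B i)) < \<epsilon> / (2 * (real N + 1))"
      by metis
    \<comment> \<open>A common length that dominates all \<open>n i\<close>; longer words are then
      tested on their prefixes.\<close>
    define m where "m = (\<Sum>i<N. n i)"
    define V where "V = (\<Union>i<N. {w\<in>words m. take (n i) w \<in> W i})"
    have "word_event m {w\<in>words m. take (n i) w \<in> W i} = word_event (n i) (W i)" if "i < N" for i
    proof -
      have "n i \<le> m"
        using that unfolding m_def by (intro member_le_sum) auto
      then show ?thesis
        by (auto simp: word_event_def take_initial_word)
    qed
    then have V: "word_event m V = (\<Union>i<N. word_event (n i) (W i))"
      by (auto simp: V_def word_event_def)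
    have "((\<Union>i. B i) - word_event m V) \<union> (word_event m V - (\<Union>i. B i))
      \<subseteq> ((\<Union>i. B i) - (\<Union>i<N. B i)) \<union> (\<Union>i<N. (B i - word_event (n i) (W i)) \<union> (word_event (n i) (W i) - B i))"
      unfolding V by blast
    then have "prob (((\<Union>i. B i) - word_event m V) \<union> (word_event m V - (\<Union>i. B i)))
      \<le> prob (((\<Union>i. B i) - (\<Union>i<N. B i)) \<union> (\<Union>i<N. (B i - word_event (n i) (W i)) \<union> (word_event (n i) (W i) - B i)))"
      using meas
      by (intro finite_measure_mono sets.Un sets.Diff sets.finite_UN sets.countable_UN)
        (auto intro!: sets.Un sets.Diff simp: sets_word_event)
    also have "\<dots> \<le> prob ((\<Union>i. B i) - (\<Union>i<N. B i)) + prob (\<Union>i<N. (B i - word_event (n i) (W i)) \<union> (word_event (n i) (W i) - B i))"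
      using meas
      by (intro measure_Un_le sets.Un sets.Diff sets.finite_UN sets.countable_UN)
        (auto intro!: sets.Un sets.Diff simp: sets_word_event)
    also have "prob (\<Union>i<N. (B i - word_event (n i) (W i)) \<union> (word_event (n i) (W i) - B i))
       \<le> (\<Sum>i<N. prob ((B i - word_event (n i) (W i)) \<union> (word_event (n i) (W i) - B i)))"
      using meas by (intro finite_measure_subadditive_finite) (auto intro!: sets.Un sets.Diff)
    also have "\<dots> \<le> (\<Sum>i<N. \<epsilon> / (2 * (real N + 1)))"
      using W(2) by (intro sum_mono less_imp_le)
    also have "\<dots> \<le> \<epsilon> / 2"
      using Union.prems by (simp add: field_simps)
    also have "prob ((\<Union>i. B i) - (\<Union>i<N. B i)) = prob (\<Union>i. B i) - prob (\<Union>i<N. B i)"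
      using meas by (intro finite_measure_Diff) auto
    finally show ?case
      using N by (intro exI[of _ m] exI[of _ V]) (auto simp: V_def)
  qed
qed

text \<open>A reverse of the decoupling inequality, obtained by summing over gaps: the gap after
  which v is likely depends on the hidden state reached after u, so all j \<le> \<tau> are added
  up.\<close>

lemma sum_word_prob_gap_ge:
  assumes rec: "\<forall>w s. \<exists>j\<le>\<tau>. (\<Sum>u\<in>words j. em (u @ w) s) \<ge> c * word_prob P w"
  shows "(\<Sum>j\<le>\<tau>. \<Sum>x\<in>words j. word_prob P (u @ x @ v)) \<ge> c * word_prob P u * word_prob P v"
proof -
  have *: "(\<Sum>j\<le>\<tau>. \<Sum>x\<in>words j. em (x @ v) t) \<ge> c * word_prob P v * 1" for t
  proof -
    obtain j where j: "j \<le> \<tau>" "(\<Sum>u\<in>words j. em (u @ v) t) \<ge> c * word_prob P v"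
      using rec by blast
    note j(2)
    also have "(\<Sum>u\<in>words j. em (u @ v) t) \<le> (\<Sum>j\<le>\<tau>. \<Sum>x\<in>words j. em (x @ v) t)"
      using j(1) by (intro member_le_sum[of j _ "\<lambda>j. \<Sum>x\<in>words j. em (x @ v) t"] sum_nonneg em_nonneg) auto
    finally show ?thesis
      by simp
  qed
  have "c * word_prob P u * word_prob P v = (\<Sum>s\<in>UNIV. p $ s * emit T R (\<lambda>t. c * word_prob P v * 1) u s)"
    unfolding emit_cmult by (simp add: word_prob_eq_emit[of u] sum_distrib_left sum_distrib_right ac_simps)
  also have "\<dots> \<le> (\<Sum>s\<in>UNIV. p $ s * emit T R (\<lambda>t. \<Sum>j\<le>\<tau>. \<Sum>x\<in>words j. em (x @ v) t) u s)"
    by (intro sum_mono mult_left_mono p_nonneg emit_mono stoch_T stoch_R *)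
  also have "\<dots> = (\<Sum>s\<in>UNIV. \<Sum>j\<le>\<tau>. \<Sum>x\<in>words j. p $ s * em (u @ x @ v) s)"
    by (simp add: emit_sum sum_distrib_left flip: emit_append)
  also have "\<dots> = (\<Sum>j\<le>\<tau>. \<Sum>s\<in>UNIV. \<Sum>x\<in>words j. p $ s * em (u @ x @ v) s)"
    by (rule sum.swap)
  also have "\<dots> = (\<Sum>j\<le>\<tau>. \<Sum>x\<in>words j. \<Sum>s\<in>UNIV. p $ s * em (u @ x @ v) s)"
    by (intro sum.cong refl sum.swap)
  finally show ?thesis
    by (simp add: word_prob_eq_emit)
qed

lemma prob_word_event_gap:
  assumes U: "U \<subseteq> words m" and V: "V \<subseteq> words n"
  shows "prob (word_event m U \<inter> (shift ^^ (m + j)) -` word_event n V)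
       = (\<Sum>u\<in>U. \<Sum>v\<in>V. \<Sum>x\<in>words j. word_prob P (u @ x @ v))"
proof -
  let ?A = "U \<times> words j \<times> V" and ?g = "\<lambda>(u, x, v). u @ x @ v"
  have "word_event m U \<inter> (shift ^^ (m + j)) -` word_event n V = word_event (m + (j + n)) (?g ` ?A)"
  proof (intro set_eqI iffI)
    fix y assume "y \<in> word_event m U \<inter> (shift ^^ (m + j)) -` word_event n V"
    then show "y \<in> word_event (m + (j + n)) (?g ` ?A)"
      unfolding word_event_def initial_word_add
      by (auto intro!: image_eqI[of _ _ "(initial_word m y, initial_word j ((shift ^^ m) y), initial_word n ((shift ^^ (m + j)) y))"]
          simp: funpow_add[symmetric] funpow_shift ac_simps)
  next
    fix y assume "y \<in> word_event (m + (j + n)) (?g ` ?A)"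
    then obtain u x v where uxv: "u \<in> U" "length x = j" "v \<in> V" "initial_word (m + (j + n)) y = u @ x @ v"
      by (auto simp: word_event_def)
    then have "length u = m" "length v = n"
      using U V by auto
    moreover have "(shift ^^ (m + j)) y = (shift ^^ j) ((shift ^^ m) y)"
      by (simp add: funpow_shift ac_simps)
    ultimately have "initial_word m y = u" "initial_word n ((shift ^^ (m + j)) y) = v"
      using uxv(2,4) by (simp_all add: initial_word_add)
    with uxv show "y \<in> word_event m U \<inter> (shift ^^ (m + j)) -` word_event n V"
      by (auto simp: word_event_def)
  qed
  then have "prob (word_event m U \<inter> (shift ^^ (m + j)) -` word_event n V) = (\<Sum>w\<in>?g ` ?A. word_prob P w)"
    using U V by (simp only:) (rule prob_word_event, fastforce)
  also have "\<dots> = (\<Sum>a\<in>?A. word_prob P (?g a))"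
    using U V by (subst sum.reindex) (auto simp: inj_on_def subset_iff)
  also have "\<dots> = (\<Sum>u\<in>U. \<Sum>x\<in>words j. \<Sum>v\<in>V. word_prob P (u @ x @ v))"
    by (simp add: sum.cartesian_product case_prod_unfold)
  also have "\<dots> = (\<Sum>u\<in>U. \<Sum>v\<in>V. \<Sum>x\<in>words j. word_prob P (u @ x @ v))"
    by (intro sum.cong refl sum.swap)
  finally show ?thesis .
qed

text \<open>Approximate \<open>A\<close> by an event \<open>C\<close> on the first \<open>n\<close> letters, with complement \<open>C'\<close>. By recurrence, the
  events that \<open>C'\<close> holds now and \<open>C\<close> after \<open>n + j\<close> shifts, \<open>j \<le> \<tau>\<close>, have total probability at least
  \<open>c P(C') P(C)\<close>; but each is almost contained in \<open>A \<inter> - A\<close>.\<close>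

theorem shift_ergodic:
  assumes A: "A \<in> sets P" and sub: "shift -` A \<subseteq> A"
  shows "prob A = 0 \<or> prob A = 1"
proof -
  obtain \<tau> c where c: "c > 0" and rec: "\<forall>w s. \<exists>j\<le>\<tau>. (\<Sum>u\<in>words j. em (u @ w) s) \<ge> c * word_prob P w"
    using recurrence_emit by blast
  have subm: "(shift ^^ m) -` A \<subseteq> A" for m
  proof (induction m)
    case (Suc m)
    then show ?case
      using sub by (auto simp: funpow_swap1)
  qed simp
  define a where "a = prob A"
  have bound: "c * (1 - a - \<epsilon>) * (a - \<epsilon>) \<le> 2 * (real \<tau> + 1) * \<epsilon>" if \<epsilon>: "\<epsilon> > 0" "\<epsilon> < a" "\<epsilon> < 1 - a" for \<epsilon>
  proof -
    obtain n W where W: "W \<subseteq> words n" and less: "prob ((A - word_event n W) \<union> (word_event n W - A)) < \<epsilon>"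
      using approximation_by_words[OF A \<epsilon>(1)] by blast
    define C where "C = word_event n W"
    define C' where "C' = word_event n (words n - W)"
    have C': "C' = UNIV - C"
      by (auto simp: C_def C'_def word_event_def)
    have [simp]: "C \<in> sets sequence_algebra" "C' \<in> sets sequence_algebra"
      by (simp_all add: C_def C'_def sets_word_event)
    have D: "(A - C) \<union> (C - A) \<in> sets P"
      using A by (intro sets.Un sets.Diff) (simp_all add: C_def sets_word_event)
    have AC: "prob (A - C) < \<epsilon>" and CA: "prob (C - A) < \<epsilon>"
      using less finite_measure_mono[OF _ D, of "A - C"] finite_measure_mono[OF _ D, of "C - A"]
      by (simp_all add: C_def)
    have "a \<le> prob C + prob (A - C)" "prob C \<le> a + prob (C - A)"
      using A finite_measure_mono[of A "C \<union> (A - C)"] measure_Un_le[of C P "A - C"]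
        finite_measure_mono[of C "A \<union> (C - A)"] measure_Un_le[of A P "C - A"]
      by (auto simp: a_def sets.Un sets.Diff)
    then have pC: "prob C \<ge> a - \<epsilon>" "prob C' \<ge> 1 - a - \<epsilon>"
      using AC CA prob_compl[of C] by (auto simp: C')
    have le: "prob (C' \<inter> (shift ^^ (n + j)) -` C) \<le> 2 * \<epsilon>" for j
    proof -
      \<comment> \<open>Let y be a point on the left. If its shifted copy is outside A, that copy
        lies in C - A; otherwise y itself is in A by \<open>subm\<close>, and y is not in C.\<close>
      have "C' \<inter> (shift ^^ (n + j)) -` C \<subseteq> (shift ^^ (n + j)) -` (C - A) \<union> (A - C)"
        using subm[of "n + j"] by (auto simp: C')
      then have "prob (C' \<inter> (shift ^^ (n + j)) -` C) \<le> prob ((shift ^^ (n + j)) -` (C - A) \<union> (A - C))"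
        using A by (intro finite_measure_mono) (auto intro!: sets.Un sets_vimage_shift)
      also have "\<dots> \<le> prob ((shift ^^ (n + j)) -` (C - A)) + prob (A - C)"
        using A by (intro measure_Un_le) (auto intro!: sets_vimage_shift)
      also have "prob ((shift ^^ (n + j)) -` (C - A)) = prob (C - A)"
        using A by (intro prob_vimage_shift) auto
      finally show ?thesis
        using AC CA by simp
    qed
    have "c * (1 - a - \<epsilon>) * (a - \<epsilon>) \<le> c * prob C' * prob C"
      using c pC \<epsilon> by (intro mult_mono) auto
    also have "\<dots> = (\<Sum>u\<in>words n - W. \<Sum>v\<in>W. c * word_prob P u * word_prob P v)"
      using W by (simp add: C_def C'_def prob_word_event sum_distrib_left sum_distrib_right) (rule sum.swap)
    also have "\<dots> \<le> (\<Sum>u\<in>words n - W. \<Sum>v\<in>W. \<Sum>j\<le>\<tau>. \<Sum>x\<in>words j. word_prob P (u @ x @ v))"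
      by (intro sum_mono sum_word_prob_gap_ge rec)
    also have "\<dots> = (\<Sum>u\<in>words n - W. \<Sum>j\<le>\<tau>. \<Sum>v\<in>W. \<Sum>x\<in>words j. word_prob P (u @ x @ v))"
      by (intro sum.cong refl sum.swap)
    also have "\<dots> = (\<Sum>j\<le>\<tau>. \<Sum>u\<in>words n - W. \<Sum>v\<in>W. \<Sum>x\<in>words j. word_prob P (u @ x @ v))"
      by (rule sum.swap)
    also have "\<dots> = (\<Sum>j\<le>\<tau>. prob (C' \<inter> (shift ^^ (n + j)) -` C))"
      unfolding C_def C'_def using W by (subst prob_word_event_gap) auto
    also have "\<dots> \<le> (\<Sum>j\<le>\<tau>. 2 * \<epsilon>)"
      by (intro sum_mono le)
    finally show ?thesis
      by (simp add: algebra_simps)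
  qed
  show ?thesis
  proof (rule ccontr)
    assume "\<not> ?thesis"
    then have a: "a > 0" "a < 1"
      using prob_le_1[of A] by (auto simp: a_def less_le zero_less_measure_iff)
    \<comment> \<open>As \<epsilon> tends to 0 the bound becomes c (1 - a) a \<le> 0, impossible for
      0 < a < 1.\<close>
    have l1: "((\<lambda>\<epsilon>. c * (1 - a - \<epsilon>) * (a - \<epsilon>)) \<longlongrightarrow> c * (1 - a - 0) * (a - 0)) (at_right 0)"
      by (intro tendsto_intros)
    have l2: "((\<lambda>\<epsilon>. 2 * (real \<tau> + 1) * \<epsilon>) \<longlongrightarrow> 2 * (real \<tau> + 1) * 0) (at_right 0)"
      by (intro tendsto_intros)
    have ev: "\<forall>\<^sub>F \<epsilon> in at_right 0. c * (1 - a - \<epsilon>) * (a - \<epsilon>) \<le> 2 * (real \<tau> + 1) * \<epsilon>"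
      unfolding eventually_at_right[OF zero_less_one]
      using a bound by (intro exI[of _ "min a (1 - a)"]) auto
    have "c * (1 - a - 0) * (a - 0) \<le> 2 * (real \<tau> + 1) * 0"
      by (rule tendsto_le[OF _ l2 l1 ev]) simp
    moreover have "c * (1 - a) * a > 0"
      using a c by simp
    ultimately show False
      by simp
  qed
qed

end

section \<open>Superadditive functions of words and the parsing\<close>

lemma mzm_parse_Nil [simp]: "mzm_parse x [] = []"
  by (subst mzm_parse.simps) simp

lemma mzm_word_prefix: "prefix (mzm_word x y) y"
  by (auto simp: mzm_word_def take_is_prefix)

lemma take_less_mzm_word_sublist:
  assumes "k < length (mzm_word x y)"
  shows "sublist (take k y) x"
proof (cases "\<exists>k\<le>length y. \<not> sublist (take k y) x")
  case True
  then have "k < (LEAST k. \<not> sublist (take k y) x)"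
    using assms by (simp add: mzm_word_def)
  then show ?thesis
    using not_less_Least by blast
next
  case False
  then have "mzm_word x y = y"
    unfolding mzm_word_def by (rule if_not_P)
  with False assms show ?thesis
    by auto
qed

text \<open>A parsed word is minimal among the absent prefixes, so it becomes a common word once its
  last letter is removed. This also covers the final word of a parsing, which may itself occur in
  x.\<close>

lemma butlast_mzm_word_sublist:
  assumes "y \<noteq> []"
  shows "sublist (butlast (mzm_word x y)) x"
proof -
  have "mzm_word x y = take (length (mzm_word x y)) y"
    using mzm_word_prefix[of x y] by (metis append_eq_conv_conj prefix_def)
  then have "butlast (mzm_word x y) = take (length (mzm_word x y) - 1) y"
    by (metis butlast_take mzm_word_prefix One_nat_def prefix_length_le)
  moreover have "length (mzm_word x y) - 1 < length (mzm_word x y)"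
    using mzm_word_nonempty[OF assms, of x] by simp
  ultimately show ?thesis
    using take_less_mzm_word_sublist by metis
qed

text \<open>Letters remain to be parsed, so the word did not come from the terminating case; only
  the final word can occur in x.\<close>

lemma not_sublist_mzm_word:
  assumes "drop (length (mzm_word x y)) y \<noteq> []"
  shows "\<not> sublist (mzm_word x y) x"
proof (cases "\<exists>k\<le>length y. \<not> sublist (take k y) x")
  case True
  then have "\<not> sublist (take (LEAST k. \<not> sublist (take k y) x) y) x"
    by (metis (mono_tags, lifting) LeastI_ex)
  with True show ?thesis
    by (simp add: mzm_word_def)
next
  case False
  then have "mzm_word x y = y"
    unfolding mzm_word_def by (rule if_not_P)
  with False assms show ?thesis
    by auto
qed

lemma mzm_word_append_drop: "mzm_word x y @ drop (length (mzm_word x y)) y = y"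
  by (metis append_eq_conv_conj mzm_word_prefix prefix_def)

lemma sublist_mzm_word: "sublist (mzm_word x y) y"
  using mzm_word_prefix by auto

text \<open>The properties of information content on which the combinatorics of the parsing rests,
  with c in the role of ln C. Monotonicity under removal of a prefix reflects P[uv] \<le> P[v],
  valid for stationary measures.\<close>

locale superadditive_words =
  fixes f :: "'a list \<Rightarrow> real" and c :: real
  assumes nonneg: "f w \<ge> 0" and super: "f (u @ v) \<ge> f u + f v - c"
    and mono_right: "f v \<le> f (u @ v)" and c_nonneg: "c \<ge> 0"
begin

text \<open>The -1 stands for the final word, which may occur in x and then escapes the hypothesis.
  The condition on \<open>butlast w\<close> confines the hypothesis to words one letter longer than
  a common word, hence short. For empty y the left side would be c - \<theta>, of unknown
  sign.\<close>

lemma length_mzm_parse_le: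
  assumes "\<And>w. sublist w y \<Longrightarrow> sublist (butlast w) x \<Longrightarrow> \<not> sublist w x \<Longrightarrow> f w \<ge> \<theta>"
  shows "(real (length (mzm_parse x y)) - 1) * (\<theta> - c) \<le> f y \<or> y = []"
  using assms
proof (induction x y rule: mzm_parse.induct)
  case (1 x y)
  show ?case
  proof (cases "y = []")
    case False
    define w where "w = mzm_word x y"
    define z where "z = drop (length w) y"
    have y: "y = w @ z"
      unfolding w_def z_def by (simp add: mzm_word_append_drop)
    have len: "length (mzm_parse x y) = Suc (length (mzm_parse x z))"
      using False by (subst mzm_parse.simps) (simp add: w_def z_def)
    show ?thesis
    proof (cases "z = []")
      case True
      then show ?thesis
        using nonneg[of y] by (simp add: len)
    next
      case z: False
      have "sublist v y" if "sublist v z" for v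
        using that by (simp add: y sublist_append)
      then have "(real (length (mzm_parse x z)) - 1) * (\<theta> - c) \<le> f z"
        using "1.IH"[OF False] "1.prems" z by (auto simp: w_def z_def)
      moreover have "f w \<ge> \<theta>"
        using z False unfolding w_def z_def
        by (intro "1.prems" sublist_mzm_word butlast_mzm_word_sublist not_sublist_mzm_word)
      ultimately show ?thesis
        using super[of w z] by (simp add: len y[symmetric] algebra_simps)
    qed
  qed simp
qed

lemma sum_blocks_le:
  assumes "k \<ge> 1"
  shows "(\<Sum>q<length u div k. f (take k (drop (q * k) u))) \<le> f u + real (length u div k) * c"
proof (induction "length u" arbitrary: u rule: less_induct)
  case less
  show ?case
  proof (cases "length u < k")
    case True
    then show ?thesis
      using nonneg[of u] by simp
  next
    case False
    define v where "v = drop k u"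
    have len: "length u = k + length v" "length v < length u"
      using False assms by (auto simp: v_def)
    then have div: "length u div k = Suc (length v div k)"
      using assms by simp
    have "(\<Sum>q<length u div k. f (take k (drop (q * k) u)))
        = f (take k u) + (\<Sum>q<length v div k. f (take k (drop (q * k) v)))"
      unfolding div by (subst sum.lessThan_Suc_shift) (simp add: v_def add.commute)
    also have "\<dots> \<le> f (take k u) + (f v + real (length v div k) * c)"
      using less[OF len(2)] by simp
    also have "\<dots> \<le> f u + c + real (length v div k) * c"
      using super[of "take k u" v] by (simp add: v_def)
    finally show ?thesis
      unfolding div by (simp add: algebra_simps)
  qed
qed

text \<open>The windows starting at positions of residue r modulo k are disjoint blocks of u without
  its first r letters. Removing these letters does not raise f, by \<open>mono_right\<close>, so
  each of the k residues contributes at most \<open>f u\<close> plus one c per block.\<close>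

lemma sum_windows_le:
  assumes "k \<ge> 1"
  shows "(\<Sum>j | j + k \<le> length u. f (take k (drop j u))) \<le> real k * f u + real (length u) * c"
proof -
  let ?n = "length u"
  have "(\<Sum>j | j + k \<le> ?n. f (take k (drop j u)))
      = (\<Sum>(r, q)\<in>Sigma {..<k} (\<lambda>r. {..<(?n - r) div k}). f (take k (drop (q * k + r) u)))"
  proof (rule sum.reindex_bij_witness[where i="\<lambda>(r, q). q * k + r" and j="\<lambda>j. (j mod k, j div k)"])
    fix j assume "j \<in> {j. j + k \<le> ?n}"
    then have j: "j + k \<le> ?n"
      by simp
    have "j div k * k + k \<le> ?n - j mod k"
      using j div_mult_mod_eq[of j k] by linarith
    then have "Suc (j div k) * k \<le> ?n - j mod k"
      by simp
    then have "Suc (j div k) \<le> (?n - j mod k) div k"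
      using assms by (simp add: less_eq_div_iff_mult_less_eq)
    then show "(j mod k, j div k) \<in> Sigma {..<k} (\<lambda>r. {..<(?n - r) div k})"
      using assms by simp
  next
    fix b assume "b \<in> Sigma {..<k} (\<lambda>r. {..<(?n - r) div k})"
    then obtain r q where b: "b = (r, q)" "r < k" "q < (?n - r) div k"
      by auto
    then have "Suc q \<le> (?n - r) div k"
      by simp
    then have le: "Suc q * k \<le> ?n - r"
      using assms by (simp add: less_eq_div_iff_mult_less_eq)
    moreover have "?n - r > 0"
      using le assms by (cases "?n - r") auto
    ultimately show "(case b of (r, q) \<Rightarrow> q * k + r) \<in> {j. j + k \<le> ?n}"
      using b by simp
  qed (use assms in auto)
  also have "\<dots> = (\<Sum>r<k. \<Sum>q<(?n - r) div k. f (take k (drop (q * k + r) u)))"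
    by (simp add: sum.Sigma)
  also have "\<dots> \<le> (\<Sum>r<k. f u + real (?n div k) * c)"
  proof (rule sum_mono)
    fix r
    have "(\<Sum>q<(?n - r) div k. f (take k (drop (q * k + r) u))) \<le> f (drop r u) + real ((?n - r) div k) * c"
      using sum_blocks_le[OF assms, of "drop r u"] by simp
    also have "f (drop r u) \<le> f u"
      using mono_right[of "drop r u" "take r u"] by simp
    also have "real ((?n - r) div k) * c \<le> real (?n div k) * c"
      using c_nonneg by (intro mult_right_mono) (auto intro: div_le_mono)
    finally show "(\<Sum>q<(?n - r) div k. f (take k (drop (q * k + r) u))) \<le> f u + real (?n div k) * c"
      by simp
  qed
  also have "\<dots> = real k * f u + real (k * (?n div k)) * c"
    by (simp add: algebra_simps)
  also have "\<dots> \<le> real k * f u + real ?n * c"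
    using c_nonneg by (intro add_left_mono mult_right_mono) (auto simp del: of_nat_mult)
  finally show ?thesis .
qed

text \<open>With f the information content and \<theta> slightly above ln N, this marks a position
  of y where a common word of too small probability starts. The prefix is not tied to the parsing,
  so the number of bad positions can be controlled by a first moment.\<close>

definition bad_start :: "'a list \<Rightarrow> real \<Rightarrow> 'a list \<Rightarrow> bool" where
  "bad_start x \<theta> y \<longleftrightarrow> (\<exists>u. prefix u y \<and> sublist u x \<and> f u > \<theta>)"

text \<open>Only the windows inside a parsed word (without its last letter) are charged to \<open>f\<close> of
  that word; the at most \<open>k\<close> others cost \<open>B\<close> each. If the word starts at a bad
  position, all its at most \<open>m\<close> windows are charged \<open>B\<close>.\<close>

lemma sum_windows_le_parse:
  assumes "k \<ge> 1" and B: "\<And>w. length w \<le> k \<Longrightarrow> f w \<le> B" and "\<theta> \<ge> 0"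
    and "\<And>u. sublist u y \<Longrightarrow> sublist u x \<Longrightarrow> length u < m"
  shows "(\<Sum>j<length y. f (take k (drop j y)))
    \<le> real (length (mzm_parse x y)) * (real k * \<theta> + (real k + 1) * B) + real (length y) * c
      + B * real m * real (card {j. j < length y \<and> bad_start x \<theta> (drop j y)})"
  using assms(4)
proof (induction x y rule: mzm_parse.induct)
  case (1 x y)
  have B0: "B \<ge> 0"
    using B[of "[]"] nonneg[of "[]"] by simp
  show ?case
  proof (cases "y = []")
    case True
    then show ?thesis
      by simp
  next
    case False
    define w where "w = mzm_word x y"
    define z where "z = drop (length w) y"
    define b where "b = butlast w"
    have y: "y = w @ z"
      unfolding w_def z_def by (simp add: mzm_word_append_drop)
    have w: "w \<noteq> []"
      unfolding w_def by (rule mzm_word_nonempty[OF False])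
    then have wb: "w = b @ [last w]"
      by (simp add: b_def)
    then have lenw: "length w = Suc (length b)"
      by (metis length_append_singleton)
    have b_x: "sublist b x"
      unfolding b_def w_def by (rule butlast_mzm_word_sublist[OF False])
    have yb: "y = b @ last w # z"
      using y wb by (metis append.assoc append_Cons append_Nil)
    have b_y: "prefix b y"
      using yb by (rule prefixI)
    have len: "length (mzm_parse x y) = Suc (length (mzm_parse x z))"
      using False by (subst mzm_parse.simps) (simp add: w_def z_def)
    define bad where "bad y = {j. j < length y \<and> bad_start x \<theta> (drop j y)}" for y
    have fin: "finite (bad y)" for y
      unfolding bad_def by simp
    have "sublist u y" if "sublist u z" for u
      using that by (simp add: y sublist_append)
    then have IH: "(\<Sum>j<length z. f (take k (drop j z)))
      \<le> real (length (mzm_parse x z)) * (real k * \<theta> + (real k + 1) * B) + real (length z) * c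
      + B * real m * real (card (bad z))"
      using "1.IH"[OF False] "1.prems" by (simp add: w_def z_def bad_def)
    have split: "(\<Sum>j<length y. f (take k (drop j y)))
        = (\<Sum>j<length w. f (take k (drop j y))) + (\<Sum>j<length z. f (take k (drop j z)))"
    proof -
      have "(\<Sum>j<length y. f (take k (drop j y)))
          = (\<Sum>j<length w. f (take k (drop j y))) + (\<Sum>j\<in>{length w..<length y}. f (take k (drop j y)))"
        by (subst sum.union_disjoint[symmetric]) (auto simp: y intro!: sum.cong)
      also have "(\<Sum>j\<in>{length w..<length y}. f (take k (drop j y))) = (\<Sum>j<length z. f (take k (drop j z)))"
        by (rule sum.reindex_bij_witness[where i="\<lambda>j. j + length w" and j="\<lambda>j. j - length w"])
          (auto simp: y)
      finally show ?thesis .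
    qed
    have sub: "(\<lambda>j. j + length w) ` bad z \<subseteq> bad y"
      by (auto simp: bad_def y)
    have card_img: "card ((\<lambda>j. j + length w) ` bad z) = card (bad z)"
      by (rule card_image) (simp add: inj_on_def)
    show ?thesis
    proof (cases "bad_start x \<theta> y")
      case True
      \<comment> \<open>Position 0 is bad and is not a shifted bad position of z, as w is nonempty.
        So each word with a bad start uses up a bad position of its own, which pays for all of its
        windows.\<close>
      have "insert 0 ((\<lambda>j. j + length w) ` bad z) \<subseteq> bad y"
        using sub True False by (auto simp: bad_def)
      then have "card (insert 0 ((\<lambda>j. j + length w) ` bad z)) \<le> card (bad y)"
        by (intro card_mono fin)
      then have card: "card (bad z) + 1 \<le> card (bad y)"
        using w by (subst (asm) card_insert_disjoint) (auto simp: fin card_img)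
      have "length b < m"
        using b_x b_y by (intro "1.prems") auto
      then have "length w \<le> m"
        by (simp add: lenw)
      have "(\<Sum>j<length w. f (take k (drop j y))) \<le> (\<Sum>j<length w. B)"
        by (intro sum_mono B) simp
      also have "\<dots> \<le> B * real m"
        using \<open>length w \<le> m\<close> B0 by (simp add: mult.commute mult_left_mono)
      finally have 1: "(\<Sum>j<length w. f (take k (drop j y))) \<le> B * real m" .
      have "B * real m * (real (card (bad z)) + 1) \<le> B * real m * real (card (bad y))"
        using card B0 by (intro mult_left_mono) auto
      then have 2: "B * real m + B * real m * real (card (bad z)) \<le> B * real m * real (card (bad y))"
        by (simp add: algebra_simps)
      have 3: "0 \<le> real k * \<theta> + (real k + 1) * B" "real (length z) * c \<le> real (length y) * c"
        using B0 \<open>\<theta> \<ge> 0\<close> c_nonneg by (auto simp: y intro!: mult_right_mono)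
      show ?thesis
        unfolding split len bad_def[symmetric] using 1 2 3 IH by (simp add: algebra_simps)
    next
      case notbad: False
      then have fb: "f b \<le> \<theta>"
        using b_x b_y by (auto simp: bad_start_def not_less)
      have "(\<Sum>j<length w. f (take k (drop j y)))
          = (\<Sum>j | j + k \<le> length b. f (take k (drop j y))) + (\<Sum>j\<in>{j. j < length w \<and> length b < j + k}. f (take k (drop j y)))"
      proof -
        have eq: "{..<length w} = {j. j + k \<le> length b} \<union> {j. j < length w \<and> length b < j + k}"
          by (auto simp: lenw)
        have fin: "finite {j. j + k \<le> length b}" "finite {j. j < length w \<and> length b < j + k}"
          by (rule finite_subset[of _ "{..length b}"], auto)
        show ?thesis
          unfolding eq by (rule sum.union_disjoint[OF fin]) auto
      qed
      also have "(\<Sum>j | j + k \<le> length b. f (take k (drop j y))) = (\<Sum>j | j + k \<le> length b. f (take k (drop j b)))"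
        by (rule sum.cong) (simp_all add: yb)
      also have "\<dots> \<le> real k * f b + real (length b) * c"
        by (rule sum_windows_le[OF \<open>k \<ge> 1\<close>])
      also have "\<dots> \<le> real k * \<theta> + real (length w) * c"
        using fb c_nonneg by (intro add_mono mult_left_mono mult_right_mono) (auto simp: lenw)
      also have "(\<Sum>j\<in>{j. j < length w \<and> length b < j + k}. f (take k (drop j y)))
         \<le> real (card {j. j < length w \<and> length b < j + k}) * B"
        by (rule sum_bounded_above) (simp add: B)
      also have "\<dots> \<le> (real k + 1) * B"
      proof -
        \<comment> \<open>Windows that do not fit into \<open>b\<close> start among the last k
          positions of w.\<close>
        have "{j. j < length w \<and> length b < j + k} \<subseteq> {length w - k..<length w}"
          by (auto simp: lenw)
        then have "card {j. j < length w \<and> length b < j + k} \<le> card {length w - k..<length w}"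
          by (intro card_mono) auto
        then have "card {j. j < length w \<and> length b < j + k} \<le> k"
          by simp
        then show ?thesis
          using B0 by (intro mult_right_mono) auto
      qed
      finally have 1: "(\<Sum>j<length w. f (take k (drop j y))) \<le> real k * \<theta> + real (length w) * c + (real k + 1) * B"
        by simp
      have "card (bad z) \<le> card (bad y)"
        using card_mono[OF fin sub] card_img by simp
      then have 2: "B * real m * real (card (bad z)) \<le> B * real m * real (card (bad y))"
        using B0 by (intro mult_left_mono) auto
      have 3: "real (length y) * c = real (length w) * c + real (length z) * c"
        by (simp add: y algebra_simps)
      show ?thesis
        unfolding split len bad_def[symmetric] 3 using 1 2 IH by (simp add: algebra_simps)
    qed
  qed
qed

end

section \<open>Information content of words\<close>

context hidden_markov
begin

lemma sum_word_prob_append_right: "(\<Sum>v\<in>words n. word_prob P (u @ v)) = word_prob P u"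
proof -
  have "(\<Sum>v\<in>words n. word_prob P (u @ v)) = (\<Sum>s\<in>UNIV. p $ s * emit T R (\<lambda>t. \<Sum>v\<in>words n. em v t) u s)"
    by (subst emit_sum, subst sum_distrib_left, subst sum.swap) (simp add: word_prob_eq_emit emit_append)
  then show ?thesis
    by (simp add: sum_em_words word_prob_eq_emit)
qed

lemma prob_UNIV [simp]: "prob UNIV = 1"
  using prob_space by simp

lemma sum_word_prob_words: "(\<Sum>w\<in>words n. word_prob P w) = 1"
  using sum_word_prob_append_right[where n=n and u="[]"] by (simp add: word_prob_Nil)

definition lb :: real where
  "lb = (SOME \<eta>. \<eta> > 0 \<and> \<eta> \<le> 1 \<and> (\<forall>w. word_prob P w > 0 \<longrightarrow> word_prob P w \<ge> \<eta> ^ length w))"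

lemma lb: "lb > 0" "lb \<le> 1" "word_prob P w > 0 \<Longrightarrow> word_prob P w \<ge> lb ^ length w"
  using someI_ex[OF word_prob_lower_bound] unfolding lb_def by blast+

text \<open>\<open>- ln P[w]\<close>, modified on the words of probability \<open>0\<close> (where \<open>ln 0 = 0\<close> would destroy
  superadditivity) so that it is finite and superadditive on all words.\<close>

definition cost :: "'a list \<Rightarrow> real" where
  "cost w = - ln (max (word_prob P w) (lb ^ length w))"

lemma cost_eq: "word_prob P w > 0 \<Longrightarrow> cost w = - ln (word_prob P w)"
  using lb(3)[of w] by (simp add: cost_def max_absorb1)

lemma cost_arg_pos: "max (word_prob P w) (lb ^ length w) > 0"
  using lb by (auto simp: less_max_iff_disj)

lemma cost_arg_le_1: "max (word_prob P w) (lb ^ length w) \<le> 1"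
  using lb word_prob_le_1[of w] by (auto intro: power_le_one)

lemma word_prob_le_exp_cost: "word_prob P w \<le> exp (- cost w)"
  using cost_arg_pos[of w] by (simp add: cost_def)

lemma cost_le: "cost w \<le> (- ln lb) * real (length w)"
proof -
  have "ln (lb ^ length w) \<le> ln (max (word_prob P w) (lb ^ length w))"
    using lb by (intro ln_mono) auto
  then show ?thesis
    using lb by (simp add: cost_def ln_realpow mult.commute)
qed

text \<open>Both arguments of the maximum satisfy the decoupling inequality and do not increase when
  letters are prepended: the first by the bounds for the measure, the second because
  \<open>lb ^ length w\<close> is multiplicative, \<open>lb \<le> 1\<close> and
  \<open>dec \<ge> 1\<close>.\<close>

lemma cost_superadditive: "superadditive_words cost (ln dec)"
proof
  show "cost w \<ge> 0" for w
    using cost_arg_pos[of w] cost_arg_le_1[of w] by (simp add: cost_def)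
  show "ln dec \<ge> 0"
    using dec_ge_1 by simp
  fix u v
  let ?m = "\<lambda>w. max (word_prob P w) (lb ^ length w)"
  have "?m (u @ v) \<le> dec * ?m u * ?m v"
  proof (rule max.boundedI)
    have "word_prob P (u @ v) \<le> dec * word_prob P u * word_prob P v"
      by (rule word_prob_append_le)
    also have "\<dots> \<le> dec * ?m u * ?m v"
      using dec_ge_1 word_prob_nonneg lb by (intro mult_mono mult_nonneg_nonneg) (auto simp: le_max_iff_disj)
    finally show "word_prob P (u @ v) \<le> dec * ?m u * ?m v" .
    have "lb ^ length (u @ v) = 1 * lb ^ length u * lb ^ length v"
      by (simp add: power_add)
    also have "\<dots> \<le> dec * ?m u * ?m v"
      using dec_ge_1 word_prob_nonneg lb by (intro mult_mono mult_nonneg_nonneg) (auto intro: max.coboundedI2)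
    finally show "lb ^ length (u @ v) \<le> dec * ?m u * ?m v" .
  qed
  then have "ln (?m (u @ v)) \<le> ln (dec * ?m u * ?m v)"
    using cost_arg_pos[of "u @ v"] by (intro ln_mono) auto
  also have "\<dots> = ln dec + ln (?m u) + ln (?m v)"
    using cost_arg_pos[of u] cost_arg_pos[of v] dec_ge_1 by (simp add: ln_mult)
  finally show "cost (u @ v) \<ge> cost u + cost v - ln dec"
    by (simp add: cost_def)
  have "?m (u @ v) \<le> ?m v"
    using word_prob_append_le_right[of u v] lb power_decreasing[of "length v" "length (u @ v)" lb]
    by (intro max.mono) auto
  then have "ln (?m (u @ v)) \<le> ln (?m v)"
    using cost_arg_pos[of "u @ v"] by (intro ln_mono)
  then show "cost v \<le> cost (u @ v)"
    by (simp add: cost_def)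
qed

sublocale cost: superadditive_words cost "ln dec"
  by (rule cost_superadditive)

end

section \<open>Mean information under Q and its almost sure bounds\<close>

locale hidden_markov_pair =
  P: hidden_markov P p\<^sub>P T\<^sub>P R\<^sub>P + Q: hidden_markov Q p\<^sub>Q T\<^sub>Q R\<^sub>Q
  for P Q :: "(nat \<Rightarrow> 'a::finite) measure"
    and p\<^sub>P :: "real ^ 's::finite" and T\<^sub>P R\<^sub>P and p\<^sub>Q :: "real ^ 't::finite" and T\<^sub>Q R\<^sub>Q +
  assumes supp: "seq_supp Q \<subseteq> seq_supp P" and nd: "nondegenerate P Q"
begin

sublocale PQ: pair_prob_space P Q ..

abbreviation "c\<^sub>0 \<equiv> ln P.dec"
abbreviation "\<kappa> \<equiv> - ln P.lb"

lemma \<kappa>_nonneg: "\<kappa> \<ge> 0"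
  using P.lb by simp

text \<open>The support hypothesis concerns infinite sequences. A word charged by Q is a prefix of
  some point of \<open>seq_supp Q\<close>, because Q-almost every sequence has all its prefixes
  charged.\<close>

lemma word_prob_pos:
  assumes "word_prob Q w > 0"
  shows "word_prob P w > 0"
proof (cases "w = []")
  case False
  have "AE y in Q. \<forall>n. word_prob Q (initial_word n y) > 0"
    unfolding AE_all_countable
  proof
    fix n
    have "Q.prob (word_event n {v\<in>words n. word_prob Q v = 0}) = 0"
      by (subst Q.prob_word_event) auto
    then have "AE y in Q. y \<notin> word_event n {v\<in>words n. word_prob Q v = 0}"
      by (intro AE_not_in) (simp add: null_sets_def Q.emeasure_eq_measure)
    then show "AE y in Q. word_prob Q (initial_word n y) > 0"
      using Q.word_prob_nonneg by (auto simp: word_event_def less_le elim: eventually_mono)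
  qed
  moreover have "\<not> (AE y in Q. y \<notin> cylinder w)"
  proof
    assume "AE y in Q. y \<notin> cylinder w"
    then have "Q.prob (cylinder w) = 0"
      by (subst (asm) AE_iff_measurable[of "cylinder w"])
        (auto simp: cylinder_eq_word_event measure_def)
    with assms show False
      by (simp add: word_prob_def)
  qed
  ultimately obtain y where y: "\<forall>n. word_prob Q (initial_word n y) > 0" "y \<in> cylinder w"
    by (metis (mono_tags, lifting) AE_mp AE_I2)
  then have "y \<in> seq_supp P"
    using supp by (auto simp: seq_supp_def)
  moreover have "length w \<ge> 1"
    using False by (cases w) auto
  ultimately have "word_prob P (initial_word (length w) y) > 0"
    by (simp add: seq_supp_def)
  then show ?thesis
    using y by (simp add: cylinder_def)
qed (simp add: P.word_prob_Nil)

definition e :: "nat \<Rightarrow> real" where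
  "e n = (\<Sum>w\<in>words n. word_prob Q w * P.cost w)"

lemma expectation_word:
  fixes g :: "'a list \<Rightarrow> real"
  shows "integrable Q (\<lambda>y. g (initial_word n ((shift ^^ j) y)))"
    and "Q.expectation (\<lambda>y. g (initial_word n ((shift ^^ j) y))) = (\<Sum>w\<in>words n. word_prob Q w * g w)"
proof -
  let ?A = "\<lambda>w :: 'a list. {y. initial_word n ((shift ^^ j) y) \<in> {w}}"
  have A: "?A w \<in> sets sequence_algebra" for w
    using Q.sets_vimage_shift[OF sets_word_event, of j n "{w}"] by (simp add: word_event_def vimage_def)
  have eq: "(\<lambda>y. g (initial_word n ((shift ^^ j) y))) = (\<lambda>y. \<Sum>w\<in>words n. g w * indicator (?A w) y)"
  proof
    fix y
    have "(\<Sum>w\<in>words n. g w * indicator (?A w) y) = (\<Sum>w\<in>words n. if w = initial_word n ((shift ^^ j) y) then g w else 0)"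
      by (rule sum.cong) auto
    then show "g (initial_word n ((shift ^^ j) y)) = (\<Sum>w\<in>words n. g w * indicator (?A w) y)"
      by (simp add: sum.delta)
  qed
  have int: "integrable Q (\<lambda>y. g w * indicator (?A w) y)" for w
    using A by (intro integrable_mult_right integrable_real_indicator) (auto simp: Q.emeasure_eq_measure)
  then show "integrable Q (\<lambda>y. g (initial_word n ((shift ^^ j) y)))"
    unfolding eq by (intro Bochner_Integration.integrable_sum)
  have "Q.expectation (\<lambda>y. g (initial_word n ((shift ^^ j) y))) = (\<Sum>w\<in>words n. g w * Q.prob (?A w))"
    unfolding eq using int A by (subst Bochner_Integration.integral_sum) auto
  also have "\<dots> = (\<Sum>w\<in>words n. word_prob Q w * g w)"
    by (rule sum.cong[OF refl], subst Q.prob_shifted_word_event) auto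
  finally show "Q.expectation (\<lambda>y. g (initial_word n ((shift ^^ j) y))) = (\<Sum>w\<in>words n. word_prob Q w * g w)" .
qed

lemma e_superadditive: "e (m + n) \<ge> e m + e n - c\<^sub>0"
proof -
  have "(\<Sum>u\<in>words m. \<Sum>v\<in>words n. word_prob Q (u @ v) * (P.cost u + P.cost v - c\<^sub>0)) \<le> e (m + n)"
    unfolding e_def sum_words_append
    by (intro sum_mono mult_left_mono P.cost.super Q.word_prob_nonneg)
  moreover have "(\<Sum>u\<in>words m. \<Sum>v\<in>words n. word_prob Q (u @ v) * (P.cost u + P.cost v - c\<^sub>0))
     = (\<Sum>u\<in>words m. (\<Sum>v\<in>words n. word_prob Q (u @ v)) * P.cost u)
     + (\<Sum>v\<in>words n. (\<Sum>u\<in>words m. word_prob Q (u @ v)) * P.cost v)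
     - (\<Sum>u\<in>words m. (\<Sum>v\<in>words n. word_prob Q (u @ v))) * c\<^sub>0"
    unfolding sum_distrib_right
    by (subst (3) sum.swap) (simp add: algebra_simps sum.distrib sum_subtractf)
  ultimately show ?thesis
    by (simp add: Q.sum_word_prob_append_right Q.sum_word_prob_append_left Q.sum_word_prob_words e_def)
qed

lemma e_nonneg: "e n \<ge> 0"
  unfolding e_def by (intro sum_nonneg mult_nonneg_nonneg Q.word_prob_nonneg P.cost.nonneg)

lemma e_le: "e n \<le> \<kappa> * real n"
proof -
  have "e n \<le> (\<Sum>w\<in>words n. word_prob Q w * (\<kappa> * real n))"
    unfolding e_def
  proof (intro sum_mono mult_left_mono Q.word_prob_nonneg)
    show "P.cost w \<le> \<kappa> * real n" if "w \<in> words n" for w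
      using P.cost_le[of w] that by simp
  qed
  also have "\<dots> = (\<Sum>w\<in>words n. word_prob Q w) * (\<kappa> * real n)"
    by (rule sum_distrib_right[symmetric])
  finally show ?thesis
    by (simp add: Q.sum_word_prob_words)
qed

definition h :: real where
  "h = lim (\<lambda>n. e n / real n)"

lemma e_tendsto: "(\<lambda>n. e n / real n) \<longlonglongrightarrow> h" and e_le_h: "n \<ge> 1 \<Longrightarrow> e n - c\<^sub>0 \<le> h * real n"
proof -
  obtain h' where "(\<lambda>n. e n / real n) \<longlonglongrightarrow> h'" "\<forall>n\<ge>1. e n - c\<^sub>0 \<le> h' * real n"
    using superadditive_tendsto[of e c\<^sub>0 \<kappa>, OF e_superadditive e_nonneg P.cost.c_nonneg e_le] by blast
  moreover from this have "h' = h"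
    unfolding h_def by (intro limI[symmetric])
  ultimately show "(\<lambda>n. e n / real n) \<longlonglongrightarrow> h" "n \<ge> 1 \<Longrightarrow> e n - c\<^sub>0 \<le> h * real n"
    by auto
qed

lemma h_nonneg: "h \<ge> 0"
  using e_tendsto by (rule LIMSEQ_le_const) (auto simp: e_nonneg)

text \<open>The modification of \<open>cost\<close> on null words is invisible here: a word of
  positive Q-probability has positive P-probability, and the others have weight 0. In particular the
  cross entropy is finite.\<close>

lemma cross_entropy_eq: "cross_entropy Q P = ereal h"
proof -
  have "ereal (- 1 / real n) * (\<Sum>a | length a = n. ereal (word_prob Q a) * eln (word_prob P a))
      = ereal (e n / real n)" for n
  proof -
    have "ereal (word_prob Q a) * eln (word_prob P a) = ereal (- (word_prob Q a * P.cost a))" for a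
    proof (cases "word_prob Q a = 0")
      case False
      then have "word_prob P a > 0"
        using word_prob_pos[of a] Q.word_prob_nonneg[of a] by simp
      then show ?thesis
        by (simp add: eln_def P.cost_eq)
    qed (simp add: zero_ereal_def[symmetric])
    then show ?thesis
      by (simp add: e_def sum_negf)
  qed
  then have "cross_entropy Q P = lim (\<lambda>n. ereal (e n / real n))"
    unfolding cross_entropy_def by simp
  also have "\<dots> = ereal h"
    using e_tendsto by (intro limI tendsto_ereal)
  finally show ?thesis .
qed

lemma measurable_word_function:
  "(\<lambda>y. g (initial_word n ((shift ^^ j) y)) :: real) \<in> borel_measurable Q"
  using expectation_word(1)[of g n j] by (rule borel_measurable_integrable)

text \<open>Reversing the sign and adding \<open>c\<^sub>0\<close> turns superadditivity up to
  \<open>c\<^sub>0\<close> into exact subadditivity; the means are then controlled for every n \<ge>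
  1 by \<open>e_le_h\<close>.\<close>

lemma cost_upper:
  assumes "\<epsilon> > 0"
  shows "AE y in Q. \<forall>\<^sub>F n in sequentially. P.cost (initial_word n y) \<le> (h + \<epsilon>) * real n + c\<^sub>0"
proof -
  have "AE y in Q. \<forall>\<^sub>F n in sequentially. c\<^sub>0 - P.cost (initial_word n y) \<ge> (- h - \<epsilon>) * real n"
  proof (rule Q.subadditive_ergodic_lower[where T=shift and \<gamma>="- h" and K="c\<^sub>0 + \<kappa>"])
    show "(\<lambda>y. c\<^sub>0 - P.cost (initial_word n y)) \<in> borel_measurable Q" for n
      using measurable_word_function[of P.cost n 0] by simp
    show "c\<^sub>0 - P.cost (initial_word (m + n) x)
        \<le> c\<^sub>0 - P.cost (initial_word m x) + (c\<^sub>0 - P.cost (initial_word n ((shift ^^ m) x)))" for m n x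
      using P.cost.super[of "initial_word m x" "initial_word n ((shift ^^ m) x)"]
      by (simp add: initial_word_add)
    show "\<bar>c\<^sub>0 - P.cost (initial_word n x)\<bar> \<le> (c\<^sub>0 + \<kappa>) * real n" if "n \<ge> 1" for n and x :: "nat \<Rightarrow> 'a"
    proof -
      have "c\<^sub>0 * 1 \<le> c\<^sub>0 * real n" "\<kappa> * real n \<ge> 0"
        using that P.cost.c_nonneg \<kappa>_nonneg by (intro mult_left_mono mult_nonneg_nonneg; simp)+
      then show ?thesis
        using P.cost_le[of "initial_word n x"] P.cost.nonneg[of "initial_word n x"] P.cost.c_nonneg
        by (simp add: abs_le_iff algebra_simps)
    qed
    show "- h * real n \<le> Q.expectation (\<lambda>y. c\<^sub>0 - P.cost (initial_word n y))" if "n \<ge> 1" for n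
      using e_le_h[OF that] expectation_word[of P.cost n 0] by (simp add: Q.prob_space e_def)
    show "Q.prob A = 0 \<or> Q.prob A = 1" if "A \<in> sets Q" "shift -` A \<inter> space Q \<subseteq> A" for A
      using Q.shift_ergodic that by simp
  qed (use assms in \<open>auto simp: Q.prob_vimage_shift\<close>)
  then show ?thesis
    by (auto simp: algebra_simps elim!: eventually_mono)
qed

text \<open>Window sums are additive along the orbit, with mean \<open>e k\<close> per step, so this
  is one half of Birkhoff's theorem.\<close>

lemma window_sum_lower:
  assumes "\<gamma> < e k"
  shows "AE y in Q. \<forall>\<^sub>F n in sequentially. (\<Sum>j<n. P.cost (initial_word k ((shift ^^ j) y))) \<ge> \<gamma> * real n"
proof (rule Q.subadditive_ergodic_lower[where T=shift and \<gamma>="e k" and K="\<kappa> * real k"])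
  show "(\<lambda>y. \<Sum>j<n. P.cost (initial_word k ((shift ^^ j) y))) \<in> borel_measurable Q" for n
    by (intro borel_measurable_sum measurable_word_function)
  show "(\<Sum>j<m + n. P.cost (initial_word k ((shift ^^ j) x))) \<le> (\<Sum>j<m. P.cost (initial_word k ((shift ^^ j) x)))
     + (\<Sum>j<n. P.cost (initial_word k ((shift ^^ j) ((shift ^^ m) x))))" for m n and x :: "nat \<Rightarrow> 'a"
    by (induction n) (simp_all add: funpow_add add.commute[of m])
  show "\<bar>\<Sum>j<n. P.cost (initial_word k ((shift ^^ j) x))\<bar> \<le> \<kappa> * real k * real n" for n and x :: "nat \<Rightarrow> 'a"
  proof -
    have "(\<Sum>j<n. P.cost (initial_word k ((shift ^^ j) x))) \<le> (\<Sum>j<n. \<kappa> * real k)"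
      using P.cost_le by (intro sum_mono) (metis length_initial_word)
    then show ?thesis
      by (simp add: sum_nonneg P.cost.nonneg mult.commute)
  qed
  show "e k * real n \<le> Q.expectation (\<lambda>y. \<Sum>j<n. P.cost (initial_word k ((shift ^^ j) y)))" for n
    by (simp add: expectation_word e_def[symmetric] mult.commute)
  show "Q.prob A = 0 \<or> Q.prob A = 1" if "A \<in> sets Q" "shift -` A \<inter> space Q \<subseteq> A" for A
    using Q.shift_ergodic that by simp
qed (use assms in \<open>auto simp: Q.prob_vimage_shift\<close>)

text \<open>At the argument -1 the sum inside the pressure is the probability that independent words
  of length n drawn from P and Q coincide. Nondegeneracy thus says that coincidences are
  exponentially rare.\<close>

lemma sum_prod_word_prob_le:
  "\<exists>\<delta>>0. \<forall>\<^sub>F n in sequentially. (\<Sum>w\<in>words n. word_prob P w * word_prob Q w) \<le> exp (- \<delta> * real n)"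
proof -
  define S where "S n = (\<Sum>a\<in>word_supp P n. word_prob P a powr (- (- 1)) * word_prob Q a)" for n
  have S: "S n = (\<Sum>w\<in>words n. word_prob P w * word_prob Q w)" for n
    unfolding S_def using P.word_prob_nonneg
    by (intro sum.mono_neutral_cong_left) (auto simp: word_supp_def less_le)
  have "limsup (\<lambda>n. ereal (1 / real n) * eln (S n)) < 0"
    using nd by (simp add: nondegenerate_def upper_cross_pressure_def cross_pressure_n_def S_def)
  then obtain r where r: "limsup (\<lambda>n. ereal (1 / real n) * eln (S n)) < ereal r" "ereal r < 0"
    using ereal_dense2 by blast
  have "\<forall>\<^sub>F n in sequentially. ereal (1 / real n) * eln (S n) < ereal r"
    using r(1) by (rule Limsup_lessD)
  then have "\<forall>\<^sub>F n in sequentially. S n \<le> exp (- (- r) * real n)"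
    using eventually_gt_at_top[of 0]
  proof eventually_elim
    case (elim n)
    show ?case
    proof (cases "S n = 0")
      case False
      have "S n \<ge> 0"
        unfolding S by (intro sum_nonneg mult_nonneg_nonneg P.word_prob_nonneg Q.word_prob_nonneg)
      with False have "S n > 0"
        by simp
      moreover have "ln (S n) < r * real n"
        using elim False by (simp add: eln_def field_simps)
      ultimately have "S n < exp (r * real n)"
        by (metis exp_less_cancel_iff exp_ln)
      then show ?thesis
        by simp
    qed simp
  qed
  then show ?thesis
    using r(2) S by (intro exI[of _ "- r"]) auto
qed

end

section \<open>Common words of the two sequences\<close>

lemma sublist_initial_word:
  assumes "sublist w (initial_word N x)"
  obtains j where "j + length w \<le> N" "initial_word (length w) ((shift ^^ j) x) = w"
proof -
  obtain u v where uv: "initial_word N x = u @ w @ v"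
    using assms by (auto simp: sublist_def)
  then have N: "N = length u + (length w + length v)"
    by (metis length_append length_initial_word)
  with uv have "initial_word (length w) ((shift ^^ length u) x) = w"
    by (simp add: initial_word_add)
  with N that[of "length u"] show ?thesis
    by simp
qed

definition occurs :: "nat \<Rightarrow> 'a list \<Rightarrow> (nat \<Rightarrow> 'a) set" where
  "occurs N w = {x. sublist w (initial_word N x)}"

lemma occurs_eq: "occurs N w = word_event N {v. sublist w v}"
  by (simp add: occurs_def word_event_def)

lemma sets_occurs [simp]: "occurs N w \<in> sets (sequence_algebra :: (nat \<Rightarrow> 'a::finite) measure)"
  by (simp add: occurs_eq)

lemma sets_not_occurs [simp]: "- occurs N w \<in> sets (sequence_algebra :: (nat \<Rightarrow> 'a::finite) measure)"
  using sets.compl_sets[OF sets_occurs[of N w]] by (simp add: space_sequence_algebra Compl_eq_Diff_UNIV)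

context hidden_markov
begin

lemma prob_occurs_le: "prob (occurs N w) \<le> (real N + 1) * word_prob P w"
proof -
  let ?A = "\<lambda>j. (shift ^^ j) -` word_event (length w) {w}"
  have "occurs N w \<subseteq> (\<Union>j\<in>{..N}. ?A j)"
  proof
    fix x assume "x \<in> occurs N w"
    then obtain j where "j + length w \<le> N" "initial_word (length w) ((shift ^^ j) x) = w"
      by (auto simp: occurs_def elim: sublist_initial_word)
    then show "x \<in> (\<Union>j\<in>{..N}. ?A j)"
      by (intro UN_I[of j]) (auto simp: word_event_def)
  qed
  then have "prob (occurs N w) \<le> prob (\<Union>j\<in>{..N}. ?A j)"
    by (intro finite_measure_mono) (auto intro!: sets.finite_UN sets_vimage_shift)
  also have "\<dots> \<le> (\<Sum>j\<in>{..N}. prob (?A j))"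
    by (intro finite_measure_subadditive_finite) (auto intro!: sets_vimage_shift)
  also have "\<dots> = (\<Sum>j\<in>{..N}. word_prob P w)"
    by (intro sum.cong refl, subst prob_vimage_shift) (auto simp: word_prob_def cylinder_eq_word_event)
  finally show ?thesis
    by (simp add: add.commute)
qed

lemma prob_not_occurs_le:
  assumes c: "0 < c" "c \<le> 1"
    and rec: "\<forall>w s. \<exists>j\<le>\<tau>. (\<Sum>u\<in>words j. em (u @ w) s) \<ge> c * word_prob P w"
    and N: "m * (\<tau> + length w) \<le> N"
  shows "prob (- occurs N w) \<le> (1 - c * word_prob P w) ^ m"
proof -
  let ?n = "m * (\<tau> + length w)"
  have "- occurs N w \<subseteq> word_event ?n {u\<in>words ?n. \<not> sublist w u}"
  proof
    fix x assume "x \<in> - occurs N w"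
    moreover have "initial_word N x = initial_word ?n x @ initial_word (N - ?n) ((shift ^^ ?n) x)"
      using N by (simp flip: initial_word_add)
    ultimately show "x \<in> word_event ?n {u\<in>words ?n. \<not> sublist w u}"
      by (auto simp: occurs_def word_event_def sublist_append)
  qed
  then have "prob (- occurs N w) \<le> prob (word_event ?n {u\<in>words ?n. \<not> sublist w u})"
    by (intro finite_measure_mono) auto
  also have "\<dots> = (\<Sum>u\<in>{u\<in>words ?n. \<not> sublist w u}. word_prob P u)"
    by (rule prob_word_event) auto
  also have "\<dots> = (\<Sum>s\<in>UNIV. p $ s * (\<Sum>u\<in>{u\<in>words ?n. \<not> sublist w u}. em u s))"
    unfolding word_prob_eq_emit sum_distrib_left by (rule sum.swap)
  also have "\<dots> \<le> (\<Sum>s\<in>UNIV. p $ s * (1 - c * word_prob P w) ^ m)"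
    by (intro sum_mono mult_left_mono sum_avoid_le[OF c rec] p_nonneg)
  also have "\<dots> = (1 - c * word_prob P w) ^ m"
    by (simp add: sum_p flip: sum_distrib_right)
  finally show ?thesis .
qed

end

definition log_length :: "real \<Rightarrow> nat \<Rightarrow> nat" where
  "log_length K N = nat \<lceil>K * ln (real N)\<rceil>"

lemma log_length_le: "K \<ge> 0 \<Longrightarrow> N \<ge> 1 \<Longrightarrow> real (log_length K N) \<le> K * ln (real N) + 1"
  by (simp add: log_length_def)

lemma log_length_ge: "real (log_length K N) \<ge> K * ln (real N)"
  unfolding log_length_def by linarith

lemma log_length_mono: "K \<ge> 0 \<Longrightarrow> 1 \<le> M \<Longrightarrow> M \<le> N \<Longrightarrow> log_length K M \<le> log_length K N"
  unfolding log_length_def by (intro nat_mono ceiling_mono mult_left_mono) auto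

lemma summable_if_bigo_inverse_square:
  fixes f :: "nat \<Rightarrow> real"
  assumes "f \<in> O(\<lambda>n. 1 / real n ^ 2)"
  shows "summable f"
  by (rule summable_comparison_test_bigo[OF _ assms]) (use inverse_power_summable[of 2, where 'a=real] in \<open>simp add: field_simps\<close>)

context hidden_markov_pair
begin

abbreviation "PQ \<equiv> P \<Otimes>\<^sub>M Q"

text \<open>Product sets, so that independence separates the condition on x from the appearance of w
  at position j of y, which by stationarity has probability Q[w] for every j.\<close>

definition rect :: "(nat \<Rightarrow> 'a) set \<Rightarrow> nat \<Rightarrow> 'a list \<Rightarrow> ((nat \<Rightarrow> 'a) \<times> (nat \<Rightarrow> 'a)) set" where
  "rect A j w = A \<times> (shift ^^ j) -` word_event (length w) {w}"

lemma rect_iff: "(x, y) \<in> rect A j w \<longleftrightarrow> x \<in> A \<and> initial_word (length w) ((shift ^^ j) y) = w"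
  by (simp add: rect_def word_event_def)

lemma sets_rect:
  "A \<in> sets sequence_algebra \<Longrightarrow> rect A j w \<in> sets (sequence_algebra \<Otimes>\<^sub>M sequence_algebra)"
  unfolding rect_def by (intro pair_measureI) (auto intro!: Q.sets_vimage_shift)

lemma measure_rect:
  assumes "A \<in> sets P"
  shows "measure PQ (rect A j w) = P.prob A * word_prob Q w"
proof -
  have "measure PQ (rect A j w) = P.prob A * Q.prob ((shift ^^ j) -` word_event (length w) {w})"
    unfolding rect_def measure_def
    using assms by (subst Q.emeasure_pair_measure_Times) (auto intro!: Q.sets_vimage_shift simp: enn2real_mult)
  then show ?thesis
    by (subst (asm) Q.prob_vimage_shift) (auto simp: word_prob_def cylinder_eq_word_event)
qed

lemma measure_UN_rect_le:
  assumes "finite W" "\<And>w. w \<in> W \<Longrightarrow> A w \<in> sets sequence_algebra"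
  shows "measure PQ (\<Union>w\<in>W. rect (A w) j w) \<le> (\<Sum>w\<in>W. P.prob (A w) * word_prob Q w)"
proof -
  have "measure PQ (\<Union>w\<in>W. rect (A w) j w) \<le> (\<Sum>w\<in>W. measure PQ (rect (A w) j w))"
    using assms by (intro PQ.P.finite_measure_subadditive_finite) (auto intro!: sets_rect)
  then show ?thesis
    using assms by (simp add: measure_rect)
qed

text \<open>At a given position y shows exactly one word of each length, so averaging the bound b
  over that word gives b again, and only the number of lengths appears. Words with Q[w] = 0 are
  exempt because positivity of P[w] is derived only for the others.\<close>

lemma measure_UN_lengths_rect_le:
  assumes W: "\<And>i. W i \<subseteq> words i" and A: "\<And>w. A w \<in> sets sequence_algebra"
    and b: "\<And>i w. i \<le> k \<Longrightarrow> w \<in> W i \<Longrightarrow> word_prob Q w > 0 \<Longrightarrow> P.prob (A w) \<le> b" and "b \<ge> 0"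
  shows "measure PQ (\<Union>i\<in>{..k}. \<Union>w\<in>W i. rect (A w) j w) \<le> (real k + 1) * b"
proof -
  have fin: "finite (W i)" for i
    using W finite_words by (rule finite_subset)
  have "measure PQ (\<Union>i\<in>{..k}. \<Union>w\<in>W i. rect (A w) j w) \<le> (\<Sum>i\<in>{..k}. measure PQ (\<Union>w\<in>W i. rect (A w) j w))"
    using fin by (intro PQ.P.finite_measure_subadditive_finite) (auto intro!: sets.finite_UN sets_rect A)
  also have "\<dots> \<le> (\<Sum>i\<in>{..k}. b)"
  proof (rule sum_mono)
    fix i assume "i \<in> {..k}"
    have "measure PQ (\<Union>w\<in>W i. rect (A w) j w) \<le> (\<Sum>w\<in>W i. P.prob (A w) * word_prob Q w)"
      by (rule measure_UN_rect_le[OF fin A])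
    also have "\<dots> \<le> (\<Sum>w\<in>W i. b * word_prob Q w)"
    proof (rule sum_mono)
      fix w assume w: "w \<in> W i"
      show "P.prob (A w) * word_prob Q w \<le> b * word_prob Q w"
      proof (cases "word_prob Q w > 0")
        case True
        then show ?thesis
          using b[OF _ w True] \<open>i \<in> {..k}\<close> by (intro mult_right_mono) auto
      next
        case False
        then show ?thesis
          using Q.word_prob_nonneg[of w] by simp
      qed
    qed
    also have "\<dots> \<le> (\<Sum>w\<in>words i. b * word_prob Q w)"
      using W \<open>b \<ge> 0\<close> Q.word_prob_nonneg by (intro sum_mono2) auto
    also have "\<dots> = b"
      by (simp add: Q.sum_word_prob_words flip: sum_distrib_left)
    finally show "measure PQ (\<Union>w\<in>W i. rect (A w) j w) \<le> b" .
  qed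
  finally show ?thesis
    by (simp add: add.commute)
qed

section \<open>Almost sure statements about common words, by the Borel-Cantelli lemma\<close>

lemma borel_cantelli_PQ:
  assumes "\<And>n. A n \<in> sets PQ" "summable (\<lambda>n. measure PQ (A n))"
  shows "AE \<omega> in PQ. \<forall>\<^sub>F n in sequentially. \<omega> \<notin> A n"
  using borel_cantelli_AE1[of A PQ] assms
  by (auto simp: PQ.P.emeasure_eq_measure elim!: eventually_mono)

text \<open>A common word of length at least L contains one of length exactly L, so one length
  suffices. There are about N^2 pairs of positions, each coinciding with probability at most
  exp(-\<delta> L) for large L.\<close>

lemma common_words_short:
  "\<exists>K>0. AE (x, y) in PQ. \<forall>\<^sub>F N in sequentially.
     \<forall>u. sublist u (initial_word N y) \<longrightarrow> sublist u (initial_word N x) \<longrightarrow> length u < log_length K N"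
proof -
  define S where "S n = (\<Sum>w\<in>words n. word_prob P w * word_prob Q w)" for n :: nat
  obtain \<delta> where \<delta>: "\<delta> > 0" and S_ev: "\<forall>\<^sub>F n in sequentially. S n \<le> exp (- \<delta> * real n)"
    using sum_prod_word_prob_le unfolding S_def by blast
  \<comment> \<open>With L \<ge> K ln N the bound is (N + 1)^2 N^(-4), which is summable.\<close>
  define K where "K = 4 / \<delta>"
  have K: "K > 0" "\<delta> * K = 4"
    using \<delta> by (auto simp: K_def)
  have S0: "S n \<ge> 0" for n
    unfolding S_def by (intro sum_nonneg mult_nonneg_nonneg P.word_prob_nonneg Q.word_prob_nonneg)
  define A where "A N = (\<Union>j\<in>{..N}. \<Union>w\<in>words (log_length K N). rect (occurs N w) j w)" for N
  have sets_A: "A N \<in> sets PQ" for N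
    unfolding A_def by (auto intro!: sets.finite_UN sets_rect)
  have meas_A: "measure PQ (A N) \<le> (real N + 1) ^ 2 * S (log_length K N)" for N
  proof -
    let ?W = "words (log_length K N) :: 'a list set"
    have "measure PQ (A N) \<le> (\<Sum>j\<in>{..N}. measure PQ (\<Union>w\<in>?W. rect (occurs N w) j w))"
      unfolding A_def by (intro PQ.P.finite_measure_subadditive_finite) (auto intro!: sets.finite_UN sets_rect)
    also have "\<dots> \<le> (\<Sum>j\<in>{..N}. \<Sum>w\<in>?W. P.prob (occurs N w) * word_prob Q w)"
      by (intro sum_mono measure_UN_rect_le) auto
    also have "\<dots> \<le> (\<Sum>j\<in>{..N}. \<Sum>w\<in>?W. (real N + 1) * word_prob P w * word_prob Q w)"
      by (intro sum_mono mult_right_mono P.prob_occurs_le Q.word_prob_nonneg)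
    also have "\<dots> = (real N + 1) ^ 2 * S (log_length K N)"
      by (simp add: S_def sum_distrib_left power2_eq_square algebra_simps)
    finally show ?thesis .
  qed
  have "filterlim (log_length K) at_top sequentially"
  proof -
    have "filterlim (\<lambda>N. K * ln (real N)) at_top sequentially"
      using K by real_asymp
    then have "filterlim (\<lambda>N. real (log_length K N)) at_top sequentially"
      by (rule filterlim_at_top_mono) (simp add: log_length_ge)
    then show ?thesis
      by (simp add: filterlim_real_sequentially filterlim_sequentially_iff_filterlim_real)
  qed
  then have "\<forall>\<^sub>F N in sequentially. S (log_length K N) \<le> exp (- \<delta> * real (log_length K N))"
    using S_ev by (rule eventually_compose_filterlim[rotated])
  then have "\<forall>\<^sub>F N in sequentially. norm (measure PQ (A N)) \<le> (real N + 1) ^ 2 * exp (- 4 * ln (real N))"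
  proof eventually_elim
    case (elim N)
    have "\<delta> * (K * ln (real N)) \<le> \<delta> * real (log_length K N)"
      using \<delta> log_length_ge by (intro mult_left_mono) auto
    then have "exp (- \<delta> * real (log_length K N)) \<le> exp (- 4 * ln (real N))"
      using K by (simp add: mult.assoc[symmetric])
    then have le: "(real N + 1) ^ 2 * S (log_length K N) \<le> (real N + 1) ^ 2 * exp (- 4 * ln (real N))"
      using elim by (intro mult_left_mono order.trans[OF elim]) auto
    show ?case
      using order.trans[OF meas_A[of N] le] by simp
  qed
  moreover have "summable (\<lambda>N. (real N + 1) ^ 2 * exp (- 4 * ln (real N)))"
    by (rule summable_if_bigo_inverse_square) real_asymp
  ultimately have "summable (\<lambda>N. measure PQ (A N))"
    by (rule summable_comparison_test_ev)
  then have "AE \<omega> in PQ. \<forall>\<^sub>F N in sequentially. \<omega> \<notin> A N"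
    by (intro borel_cantelli_PQ sets_A)
  then have "AE (x, y) in PQ. \<forall>\<^sub>F N in sequentially.
     \<forall>u. sublist u (initial_word N y) \<longrightarrow> sublist u (initial_word N x) \<longrightarrow> length u < log_length K N"
  proof (rule AE_mp, intro AE_I2 impI, clarify)
    fix x y assume "\<forall>\<^sub>F N in sequentially. (x, y) \<notin> A N"
    then show "\<forall>\<^sub>F N in sequentially. \<forall>u. sublist u (initial_word N y) \<longrightarrow>
      sublist u (initial_word N x) \<longrightarrow> length u < log_length K N"
    proof eventually_elim
      case (elim N)
      show ?case
      proof (intro allI impI, rule ccontr)
        fix u assume u: "sublist u (initial_word N y)" "sublist u (initial_word N x)" "\<not> length u < log_length K N"
        define w where "w = take (log_length K N) u"
        have w: "length w = log_length K N" "sublist w u"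
          using u(3) by (auto simp: w_def)
        have wx: "sublist w (initial_word N x)" and wy: "sublist w (initial_word N y)"
          using w u sublist_order.order.trans by blast+
        obtain j where "j + length w \<le> N" "initial_word (length w) ((shift ^^ j) y) = w"
          using wy by (rule sublist_initial_word)
        then have "(x, y) \<in> A N"
          using w wx unfolding A_def
          by (intro UN_I[of j] UN_I[of w]) (auto simp: rect_iff occurs_def)
        with elim show False
          by simp
      qed
    qed
  qed
  with K show ?thesis
    by blast
qed

text \<open>About N / ln N disjoint blocks each contain w with probability at least c N^(\<epsilon>
  - 1), so w is missing with probability at most exp(-N^\<epsilon> / ln N) up to constants in the
  exponent. This beats the N positions and the logarithmically many lengths.\<close>

lemma likely_words_occur:
  assumes "0 < \<epsilon>" "\<epsilon> < 1" "K > 0"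
  shows "AE (x, y) in PQ. \<forall>\<^sub>F N in sequentially.
     \<forall>w. sublist w (initial_word N y) \<longrightarrow> length w \<le> log_length K N \<longrightarrow> \<not> sublist w (initial_word N x) \<longrightarrow>
       P.cost w \<ge> (1 - \<epsilon>) * ln (real N)"
proof -
  obtain \<tau> c where c: "c > 0" "c \<le> 1"
    and rec: "\<forall>w s. \<exists>j\<le>\<tau>. (\<Sum>u\<in>words j. P.em (u @ w) s) \<ge> c * word_prob P w"
    using P.recurrence_emit by blast
  define W where "W N i = {w\<in>words i. P.cost w < (1 - \<epsilon>) * ln (real N)}" for N i
  define A where "A N = (\<Union>j\<in>{..N}. \<Union>i\<in>{..log_length K N}. \<Union>w\<in>W N i. rect (- occurs N w) j w)" for N
  have finW: "finite (W N i)" for N i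
    unfolding W_def by simp
  have sets_A: "A N \<in> sets PQ" for N
    unfolding A_def using finW by (auto intro!: sets.finite_UN sets_rect)
  \<comment> \<open>An upper bound for the probability that w is missing: the last factor bounds the
    number m of blocks from below, its -1 coming from integer division.\<close>
  define b where "b N = exp (- (c * real N powr (\<epsilon> - 1) * (real N / (K * ln (real N) + (real \<tau> + 1)) - 1)))" for N
  have meas_A: "measure PQ (A N) \<le> (real N + 1) * ((K * ln (real N) + 2) * b N)" if N: "N \<ge> 2" for N
  proof -
    let ?k = "log_length K N"
    have k_le: "real ?k \<le> K * ln (real N) + 1"
      using N assms by (intro log_length_le) auto
    have k_pos: "real ?k > 0"
    proof -
      have "0 < K * ln (real N)"
        using N assms by simp
      then show ?thesis
        using log_length_ge[of K N] by linarith
    qed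
    have "measure PQ (A N) \<le> (\<Sum>j\<in>{..N}. measure PQ (\<Union>i\<in>{..?k}. \<Union>w\<in>W N i. rect (- occurs N w) j w))"
      unfolding A_def using finW
      by (intro PQ.P.finite_measure_subadditive_finite) (auto intro!: sets.finite_UN sets_rect)
    also have "\<dots> \<le> (\<Sum>j\<in>{..N}. (real ?k + 1) * b N)"
    proof (intro sum_mono measure_UN_lengths_rect_le)
      fix i w assume i: "i \<le> ?k" and w: "w \<in> W N i" and "word_prob Q w > 0"
      then have pos: "word_prob P w > 0"
        by (intro word_prob_pos)
      define m where "m = N div (\<tau> + ?k)"
      have len: "length w \<le> ?k"
        using i w by (simp add: W_def)
      have "m * (\<tau> + length w) \<le> m * (\<tau> + ?k)"
        using len by (intro mult_le_mono) auto
      also have "\<dots> \<le> N"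
        unfolding m_def by simp
      finally have "P.prob (- occurs N w) \<le> (1 - c * word_prob P w) ^ m"
        by (intro P.prob_not_occurs_le[OF c rec])
      also have "\<dots> \<le> exp (- (c * word_prob P w)) ^ m"
        using c P.word_prob_le_1[of w] P.word_prob_nonneg[of w] exp_ge_add_one_self[of "- (c * word_prob P w)"]
        by (intro power_mono) (auto simp: mult_le_one)
      also have "\<dots> = exp (- c * word_prob P w * real m)"
        by (simp add: exp_of_nat_mult[symmetric] algebra_simps)
      also have "\<dots> \<le> b N"
      proof -
        have "real N / (K * ln (real N) + (real \<tau> + 1)) \<le> real N / real (\<tau> + ?k)"
          using k_le k_pos by (intro divide_left_mono) (auto intro!: mult_pos_pos)
        also have "\<dots> \<le> real m + 1"
        proof -
          have "N < (\<tau> + ?k) + (\<tau> + ?k) * m"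
            using k_pos unfolding m_def by (intro dividend_less_times_div) auto
          then have "real N \<le> real ((\<tau> + ?k) + (\<tau> + ?k) * m)"
            by (simp only: of_nat_le_iff)
          then show ?thesis
            using k_pos by (simp add: pos_divide_le_eq algebra_simps)
        qed
        finally have 1: "real N / (K * ln (real N) + (real \<tau> + 1)) - 1 \<le> real m"
          by simp
        have "(\<epsilon> - 1) * ln (real N) \<le> ln (word_prob P w)"
          using w P.cost_eq[OF pos] by (simp add: W_def algebra_simps)
        then have "exp ((\<epsilon> - 1) * ln (real N)) \<le> word_prob P w"
          using pos by (metis exp_le_cancel_iff exp_ln)
        then have 2: "real N powr (\<epsilon> - 1) \<le> word_prob P w"
          using N by (simp add: powr_def)
        have "real N powr (\<epsilon> - 1) * (real N / (K * ln (real N) + (real \<tau> + 1)) - 1)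
            \<le> real N powr (\<epsilon> - 1) * real m"
          using 1 by (intro mult_left_mono) auto
        also have "\<dots> \<le> word_prob P w * real m"
          using 2 by (intro mult_right_mono) auto
        finally have "c * (real N powr (\<epsilon> - 1) * (real N / (K * ln (real N) + (real \<tau> + 1)) - 1))
           \<le> c * (word_prob P w * real m)"
          using c by (intro mult_left_mono) auto
        then show ?thesis
          unfolding b_def by (simp add: mult.assoc)
      qed
      finally show "P.prob (- occurs N w) \<le> b N" .
    qed (auto simp: W_def b_def)
    also have "\<dots> = (real N + 1) * ((real ?k + 1) * b N)"
      by simp
    also have "\<dots> \<le> (real N + 1) * ((K * ln (real N) + 2) * b N)"
      using k_le by (intro mult_left_mono mult_right_mono) (auto simp: b_def)
    finally show ?thesis .
  qed
  have "\<forall>\<^sub>F N in sequentially.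
      c * real N powr (\<epsilon> - 1) * (real N / (K * ln (real N) + (real \<tau> + 1)) - 1) \<ge> 5 * ln (real N)"
    using assms c by real_asymp
  then have "\<forall>\<^sub>F N in sequentially. norm (measure PQ (A N)) \<le> (real N + 1) * ((K * ln (real N) + 2) * exp (- 5 * ln (real N)))"
    using eventually_ge_at_top[of 2]
  proof eventually_elim
    case (elim N)
    then have "b N \<le> exp (- 5 * ln (real N))"
      by (simp add: b_def)
    moreover have "K * ln (real N) + 2 \<ge> 0"
      using elim assms by simp
    ultimately have le: "(real N + 1) * ((K * ln (real N) + 2) * b N) \<le> (real N + 1) * ((K * ln (real N) + 2) * exp (- 5 * ln (real N)))"
      by (intro mult_left_mono) auto
    show ?case
      using order.trans[OF meas_A[of N] le] elim by simp
  qed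
  moreover have "summable (\<lambda>N. (real N + 1) * ((K * ln (real N) + 2) * exp (- 5 * ln (real N))))"
  proof (rule summable_if_bigo_inverse_square)
    show "(\<lambda>N. (real N + 1) * ((K * ln (real N) + 2) * exp (- 5 * ln (real N)))) \<in> O(\<lambda>N. 1 / real N ^ 2)"
      using \<open>K > 0\<close> by real_asymp
  qed
  ultimately have "summable (\<lambda>N. measure PQ (A N))"
    by (rule summable_comparison_test_ev)
  then have "AE \<omega> in PQ. \<forall>\<^sub>F N in sequentially. \<omega> \<notin> A N"
    by (intro borel_cantelli_PQ sets_A)
  then show ?thesis
  proof (rule AE_mp, intro AE_I2 impI, clarify)
    fix x y assume "\<forall>\<^sub>F N in sequentially. (x, y) \<notin> A N"
    then show "\<forall>\<^sub>F N in sequentially. \<forall>w. sublist w (initial_word N y) \<longrightarrow> length w \<le> log_length K N \<longrightarrow>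
      \<not> sublist w (initial_word N x) \<longrightarrow> P.cost w \<ge> (1 - \<epsilon>) * ln (real N)"
    proof eventually_elim
      case (elim N)
      show ?case
      proof (intro allI impI, rule ccontr)
        fix w assume w: "sublist w (initial_word N y)" "length w \<le> log_length K N" "\<not> sublist w (initial_word N x)"
          "\<not> (1 - \<epsilon>) * ln (real N) \<le> P.cost w"
        obtain j where "j + length w \<le> N" "initial_word (length w) ((shift ^^ j) y) = w"
          using w(1) by (rule sublist_initial_word)
        then have "(x, y) \<in> A N"
          using w unfolding A_def
          by (intro UN_I[of j] UN_I[of "length w"] UN_I[of w]) (auto simp: rect_iff occurs_def W_def)
        with elim show False
          by simp
      qed
    qed
  qed
qed

text \<open>A word with P[w] \<le> N^(-1-\<epsilon>) occurs in x with probability at most 2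
  N^(-\<epsilon>), so the expected number of bad positions is of order N^(1-\<epsilon>) ln N.
  Markov's inequality at the level N^(1-\<epsilon>/2) leaves N^(-\<epsilon>/2) ln N, which is
  summable along N = 2^i.\<close>

lemma unlikely_words_rare:
  assumes "\<epsilon> > 0" "K > 0"
  shows "AE (x, y) in PQ. \<forall>\<^sub>F i in sequentially.
     real (card {j. j < 2 ^ i \<and> (\<exists>w. length w \<le> log_length K (2 ^ i) \<and> initial_word (length w) ((shift ^^ j) y) = w \<and>
        sublist w (initial_word (2 ^ i) x) \<and> P.cost w > (1 + \<epsilon>) * ln (2 ^ i))}) < (2 ^ i) powr (1 - \<epsilon> / 2)"
proof -
  define W where "W N i = {w\<in>words i. P.cost w > (1 + \<epsilon>) * ln (real N)}" for N i
  define D where "D N j = (\<Union>i\<in>{..log_length K N}. \<Union>w\<in>W N i. rect (occurs N w) j w)" for N j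
  have finW: "finite (W N i)" for N i
    unfolding W_def by simp
  have sets_D [measurable]: "D N j \<in> sets PQ" for N j
    unfolding D_def using finW by (auto intro!: sets.finite_UN sets_rect)
  define count where "count N \<omega> = (\<Sum>j<N. indicator (D N j) \<omega> :: real)" for N \<omega>
  have count_meas [measurable]: "count N \<in> borel_measurable PQ" for N
    unfolding count_def by measurable
  define A where "A i = {\<omega>\<in>space PQ. count (2 ^ i) \<omega> \<ge> (2 ^ i) powr (1 - \<epsilon> / 2)}" for i
  have sets_A: "A i \<in> sets PQ" for i
    unfolding A_def by measurable
  have meas_D: "measure PQ (D N j) \<le> (K * ln (real N) + 2) * (2 * real N * exp (- (1 + \<epsilon>) * ln (real N)))" if N: "N \<ge> 1" for N j
  proof -
    have "measure PQ (D N j) \<le> (real (log_length K N) + 1) * (2 * real N * exp (- (1 + \<epsilon>) * ln (real N)))"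
      unfolding D_def
    proof (rule measure_UN_lengths_rect_le)
      fix i w assume "w \<in> W N i"
      have "P.prob (occurs N w) \<le> (real N + 1) * word_prob P w"
        by (rule P.prob_occurs_le)
      also have "\<dots> \<le> (2 * real N) * exp (- (1 + \<epsilon>) * ln (real N))"
      proof (intro mult_mono)
        show "word_prob P w \<le> exp (- (1 + \<epsilon>) * ln (real N))"
          using P.word_prob_le_exp_cost[of w] \<open>w \<in> W N i\<close>
          by (intro order.trans[OF P.word_prob_le_exp_cost[of w]]) (simp add: W_def algebra_simps)
      qed (use N P.word_prob_nonneg in auto)
      finally show "P.prob (occurs N w) \<le> 2 * real N * exp (- (1 + \<epsilon>) * ln (real N))" .
    qed (auto simp: W_def)
    also have "\<dots> \<le> (K * ln (real N) + 2) * (2 * real N * exp (- (1 + \<epsilon>) * ln (real N)))"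
      using log_length_le[of K N] assms N by (intro mult_right_mono) auto
    finally show ?thesis .
  qed
  have meas_A: "measure PQ (A i) \<le> (K * (real i * ln 2) + 2) * (2 * exp (- (\<epsilon> / 2) * (real i * ln 2)))" for i
  proof -
    define N :: nat where "N = 2 ^ i"
    have lnN: "ln (real N) = real i * ln 2"
      by (simp add: N_def ln_realpow)
    have N: "N \<ge> 1" "real N > 0"
      by (simp_all add: N_def)
    have int: "integrable PQ (\<lambda>\<omega>. indicator (D N j) \<omega> :: real)" for j
      by (intro integrable_real_indicator sets_D) (simp add: PQ.P.emeasure_eq_measure)
    have int_count: "integrable PQ (count N)"
      unfolding count_def using int by (intro Bochner_Integration.integrable_sum)
    have "measure PQ (A i) = measure PQ {\<omega>\<in>space PQ. count N \<omega> \<ge> real N powr (1 - \<epsilon> / 2)}"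
      by (simp add: A_def N_def)
    also have "\<dots> \<le> (\<integral>\<omega>. count N \<omega> \<partial>PQ) / real N powr (1 - \<epsilon> / 2)"
    proof (rule integral_Markov_inequality_measure[where A="{}"])
      show "AE \<omega> in PQ. 0 \<le> count N \<omega>"
        unfolding count_def by (intro AE_I2 sum_nonneg) simp
    qed (use int_count N in auto)
    also have "(\<integral>\<omega>. count N \<omega> \<partial>PQ) = (\<Sum>j<N. measure PQ (D N j))"
      unfolding count_def using int by (subst Bochner_Integration.integral_sum) (auto simp: space_pair_measure)
    also have "\<dots> / real N powr (1 - \<epsilon> / 2)
      \<le> (\<Sum>j<N. (K * ln (real N) + 2) * (2 * real N * exp (- (1 + \<epsilon>) * ln (real N)))) / real N powr (1 - \<epsilon> / 2)"
      using N by (intro divide_right_mono sum_mono meas_D) auto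
    also have "\<dots> = (K * ln (real N) + 2) * (2 * (real N * real N * exp (- (1 + \<epsilon>) * ln (real N)) / real N powr (1 - \<epsilon> / 2)))"
      by simp
    also have "real N * real N * exp (- (1 + \<epsilon>) * ln (real N)) / real N powr (1 - \<epsilon> / 2)
       = exp (- (\<epsilon> / 2) * ln (real N))"
    proof -
      have "real N * real N = exp (ln (real N) + ln (real N))"
        using N by (simp only: exp_add exp_ln)
      then show ?thesis
        using N by (simp add: powr_def exp_add[symmetric] exp_diff[symmetric] algebra_simps)
    qed
    finally show ?thesis
      by (simp add: lnN)
  qed
  have "(\<lambda>i. (K * (real i * ln 2) + 2) * (2 * exp (- (\<epsilon> / 2) * (real i * ln 2)))) \<in> O(\<lambda>i. 1 / real i ^ 2)"
    using assms by real_asymp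
  then have "summable (\<lambda>i. (K * (real i * ln 2) + 2) * (2 * exp (- (\<epsilon> / 2) * (real i * ln 2))))"
    by (rule summable_if_bigo_inverse_square)
  then have "summable (\<lambda>i. measure PQ (A i))"
    by (rule summable_comparison_test'[where N=0]) (use meas_A in simp)
  then have "AE \<omega> in PQ. \<forall>\<^sub>F i in sequentially. \<omega> \<notin> A i"
    by (intro borel_cantelli_PQ sets_A)
  then show ?thesis
  proof (rule AE_mp, intro AE_I2 impI, clarify)
    fix x y assume "\<forall>\<^sub>F i in sequentially. (x, y) \<notin> A i"
    then show "\<forall>\<^sub>F i in sequentially.
     real (card {j. j < 2 ^ i \<and> (\<exists>w. length w \<le> log_length K (2 ^ i) \<and> initial_word (length w) ((shift ^^ j) y) = w \<and>
        sublist w (initial_word (2 ^ i) x) \<and> P.cost w > (1 + \<epsilon>) * ln (2 ^ i))}) < (2 ^ i) powr (1 - \<epsilon> / 2)"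
    proof eventually_elim
      case (elim i)
      have mem: "(x, y) \<in> D (2 ^ i) j \<longleftrightarrow> (\<exists>w. length w \<le> log_length K (2 ^ i) \<and> initial_word (length w) ((shift ^^ j) y) = w \<and>
        sublist w (initial_word (2 ^ i) x) \<and> P.cost w > (1 + \<epsilon>) * ln (2 ^ i))" for j
      proof
        assume "(x, y) \<in> D (2 ^ i) j"
        then obtain n w where "n \<le> log_length K (2 ^ i)" "w \<in> W (2 ^ i) n" "(x, y) \<in> rect (occurs (2 ^ i) w) j w"
          unfolding D_def by blast
        then show "\<exists>w. length w \<le> log_length K (2 ^ i) \<and> initial_word (length w) ((shift ^^ j) y) = w \<and>
            sublist w (initial_word (2 ^ i) x) \<and> P.cost w > (1 + \<epsilon>) * ln (2 ^ i)"
          by (intro exI[of _ w]) (simp add: rect_iff occurs_def W_def)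
      next
        assume "\<exists>w. length w \<le> log_length K (2 ^ i) \<and> initial_word (length w) ((shift ^^ j) y) = w \<and>
            sublist w (initial_word (2 ^ i) x) \<and> P.cost w > (1 + \<epsilon>) * ln (2 ^ i)"
        then obtain w where "length w \<le> log_length K (2 ^ i)" "initial_word (length w) ((shift ^^ j) y) = w"
            "sublist w (initial_word (2 ^ i) x)" "P.cost w > (1 + \<epsilon>) * ln (2 ^ i)"
          by blast
        then show "(x, y) \<in> D (2 ^ i) j"
          unfolding D_def by (intro UN_I[of "length w"] UN_I[of w]) (simp_all add: rect_iff occurs_def W_def)
      qed
      have "real (card {j. j < 2 ^ i \<and> (x, y) \<in> D (2 ^ i) j}) = count (2 ^ i) (x, y)"
        by (simp add: count_def indicator_def of_bool_def sum.If_cases Int_def)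
      moreover have "count (2 ^ i) (x, y) < (2 ^ i) powr (1 - \<epsilon> / 2)"
        using elim by (auto simp: A_def space_pair_measure not_le)
      ultimately show ?case
        by (simp only: mem)
    qed
  qed
qed

end

section \<open>The number of parsed words\<close>

context hidden_markov_pair
begin

lemma AE_snd:
  assumes "AE y in Q. \<phi> y"
  shows "AE (x, y) in PQ. \<phi> y"
proof -
  obtain N where N: "{y\<in>space Q. \<not> \<phi> y} \<subseteq> N" "emeasure Q N = 0" "N \<in> sets Q"
    using assms by (rule AE_E)
  show ?thesis
  proof (rule AE_I[of _ _ "space P \<times> N"])
    show "emeasure PQ (space P \<times> N) = 0"
      using N by (subst Q.emeasure_pair_measure_Times) auto
    show "space P \<times> N \<in> sets PQ"
      using N(3) by (rule pair_measureI[OF sets.top])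
  qed (use N in auto)
qed

lemma mzm_count_upper:
  assumes "b > h"
  shows "AE (x, y) in PQ. \<forall>\<^sub>F N in sequentially. real (mzm_count N y x) * ln (real N) \<le> b * real N"
proof -
  \<comment> \<open>Chosen so that all losses fit, h + 2 \<epsilon> \<le> b (1 - 2 \<epsilon>),
    while 1 - 2 \<epsilon> stays positive for the final cancellation.\<close>
  define \<epsilon> where "\<epsilon> = min (1 / 4) ((b - h) / (4 * (1 + b)))"
  have b: "b > 0"
    using assms h_nonneg by simp
  have \<epsilon>: "\<epsilon> > 0" "\<epsilon> \<le> 1 / 4" "\<epsilon> \<le> (b - h) / (4 * (1 + b))"
    unfolding \<epsilon>_def by (use assms b in simp, rule min.cobounded1, rule min.cobounded2)
  have "\<epsilon> * (4 * (1 + b)) \<le> b - h"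
    using \<epsilon>(3) b by (simp add: pos_le_divide_eq)
  then have gap: "h + 2 * \<epsilon> \<le> b * (1 - 2 * \<epsilon>)"
    using assms by (simp add: algebra_simps)
  obtain K where K: "K > 0" and short: "AE (x, y) in PQ. \<forall>\<^sub>F N in sequentially.
     \<forall>u. sublist u (initial_word N y) \<longrightarrow> sublist u (initial_word N x) \<longrightarrow> length u < log_length K N"
    using common_words_short by blast
  have "AE (x, y) in PQ. \<forall>\<^sub>F N in sequentially.
     \<forall>w. sublist w (initial_word N y) \<longrightarrow> length w \<le> log_length K N \<longrightarrow> \<not> sublist w (initial_word N x) \<longrightarrow>
       P.cost w \<ge> (1 - \<epsilon>) * ln (real N)"
    using \<epsilon> K by (intro likely_words_occur) auto
  moreover have "AE (x, y) in PQ. \<forall>\<^sub>F n in sequentially. P.cost (initial_word n y) \<le> (h + \<epsilon>) * real n + c\<^sub>0"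
    using \<epsilon> by (intro AE_snd cost_upper)
  ultimately show ?thesis
    using short
  proof eventually_elim
    case (elim \<omega>)
    obtain x y where \<omega>: "\<omega> = (x, y)"
      by (cases \<omega>)
    have "\<forall>\<^sub>F N in sequentially. real (mzm_count N y x) * ln (real N) \<le> b * real N"
    proof -
      have "\<forall>\<^sub>F N in sequentially. (1 - \<epsilon>) * ln (real N) - c\<^sub>0 \<ge> (1 - 2 * \<epsilon>) * ln (real N)"
        using \<epsilon> by real_asymp
      moreover have "\<forall>\<^sub>F N in sequentially. (1 - 2 * \<epsilon>) * ln (real N) + c\<^sub>0 \<le> \<epsilon> * real N"
        using \<epsilon> by real_asymp
      moreover note eventually_ge_at_top[of 2]
      ultimately show ?thesis
        using elim[unfolded \<omega> prod.case]
      proof eventually_elim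
        case (elim N)
        define X where "X = initial_word N x"
        define Y where "Y = initial_word N y"
        define n where "n = real (mzm_count N y x)"
        have "P.cost w \<ge> (1 - \<epsilon>) * ln (real N)" if w: "sublist w Y" "sublist (butlast w) X" "\<not> sublist w X" for w
        proof -
          \<comment> \<open>Without its last letter w is a common word, hence shorter than
            \<open>log_length K N\<close>; the last letter turns < into \<le>, the form in which
            \<open>likely_words_occur\<close> applies.\<close>
          have "sublist (butlast w) Y"
            using w(1) sublist_butlast sublist_order.order.trans by blast
          then have "length (butlast w) < log_length K N"
            using elim w by (auto simp: X_def Y_def)
          then have "length w \<le> log_length K N"
            by simp
          then show ?thesis
            using elim w by (auto simp: X_def Y_def)
        qed
        then have "(n - 1) * ((1 - \<epsilon>) * ln (real N) - c\<^sub>0) \<le> P.cost Y \<or> Y = []"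
          unfolding n_def mzm_count_def X_def Y_def by (intro P.cost.length_mzm_parse_le)
        moreover have "Y \<noteq> []"
          using elim by (metis Y_def length_initial_word list.size(3) not_numeral_le_zero)
        ultimately have main: "(n - 1) * ((1 - \<epsilon>) * ln (real N) - c\<^sub>0) \<le> (h + \<epsilon>) * real N + c\<^sub>0"
          using elim by (auto simp: Y_def)
        have "n \<ge> 1"
          using \<open>Y \<noteq> []\<close> by (simp add: n_def mzm_count_def Y_def[symmetric] mzm_parse.simps[of _ Y])
        then have "(n - 1) * ((1 - 2 * \<epsilon>) * ln (real N)) \<le> (n - 1) * ((1 - \<epsilon>) * ln (real N) - c\<^sub>0)"
          using elim by (intro mult_left_mono) auto
        \<comment> \<open>The final word, not covered by the cost estimate, is added back on the
          right, where its ln N is negligible against N.\<close>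
        with main have "n * ((1 - 2 * \<epsilon>) * ln (real N)) \<le> (h + \<epsilon>) * real N + c\<^sub>0 + (1 - 2 * \<epsilon>) * ln (real N)"
          by (simp add: algebra_simps)
        also have "\<dots> \<le> (h + 2 * \<epsilon>) * real N"
          using elim by (simp add: algebra_simps)
        also have "\<dots> \<le> b * (1 - 2 * \<epsilon>) * real N"
          using gap by (intro mult_right_mono) auto
        finally have "(1 - 2 * \<epsilon>) * (n * ln (real N)) \<le> (1 - 2 * \<epsilon>) * (b * real N)"
          by (simp add: mult_ac)
        then show ?case
          using \<epsilon> by (simp add: n_def)
      qed
    qed
    then show ?case
      by (simp add: \<omega>)
  qed
qed

text \<open>Windows of the finite word are cut off at its end, while those of the sequence are
  complete. They differ at no more than the last k positions, with a loss of at most B each.\<close>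

lemma sum_truncated_windows_ge:
  assumes B: "\<And>w. length w \<le> k \<Longrightarrow> P.cost w \<le> B" and "B \<ge> 0"
  shows "(\<Sum>j<N. P.cost (take k (drop j (initial_word N y))))
    \<ge> (\<Sum>j<N. P.cost (initial_word k ((shift ^^ j) y))) - real k * B"
proof -
  have "(\<Sum>j<N. P.cost (initial_word k ((shift ^^ j) y))) - (\<Sum>j<N. P.cost (take k (drop j (initial_word N y))))
    = (\<Sum>j<N. P.cost (initial_word k ((shift ^^ j) y)) - P.cost (take k (drop j (initial_word N y))))"
    by (simp add: sum_subtractf)
  also have "\<dots> \<le> (\<Sum>j<N. if N < j + k then B else 0)"
  proof (rule sum_mono)
    fix j assume "j \<in> {..<N}"
    show "P.cost (initial_word k ((shift ^^ j) y)) - P.cost (take k (drop j (initial_word N y))) \<le> (if N < j + k then B else 0)"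
    proof (cases "N < j + k")
      case True
      then show ?thesis
        using B[of "initial_word k ((shift ^^ j) y)"] P.cost.nonneg[of "take k (drop j (initial_word N y))"] by simp
    next
      case False
      then have "initial_word N y = initial_word (j + (N - j)) y" "k \<le> N - j"
        by auto
      then have "take k (drop j (initial_word N y)) = initial_word k ((shift ^^ j) y)"
        by (simp only: drop_initial_word take_initial_word)
      with False show ?thesis
        by simp
    qed
  qed
  also have "\<dots> = real (card {j. j < N \<and> N < j + k}) * B"
    by (simp add: sum.If_cases Int_def)
  also have "\<dots> \<le> real k * B"
  proof -
    have "card {j. j < N \<and> N < j + k} \<le> card {N - k..<N}"
      by (intro card_mono) auto
    then show ?thesis
      using \<open>B \<ge> 0\<close> by (intro mult_right_mono) auto
  qed
  finally show ?thesis
    by simp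
qed

text \<open>A word occurring in the first N letters of x also occurs in the first M. Applied with M
  a power of two, this moves bad positions for N to the form counted in
  \<open>unlikely_words_rare\<close>.\<close>

lemma bad_start_initial_word:
  assumes "P.cost.bad_start (initial_word N x) \<theta> (drop j (initial_word N y))" and "N \<le> M"
    and short: "\<forall>u. sublist u (initial_word N y) \<longrightarrow> sublist u (initial_word N x) \<longrightarrow> length u < l"
  shows "\<exists>w. length w \<le> l \<and> initial_word (length w) ((shift ^^ j) y) = w \<and> sublist w (initial_word M x) \<and> P.cost w > \<theta>"
proof -
  obtain u where u: "prefix u (drop j (initial_word N y))" "sublist u (initial_word N x)" "P.cost u > \<theta>"
    using assms(1) by (auto simp: P.cost.bad_start_def)
  have "sublist u (initial_word N y)"
    using u(1) by (meson prefix_imp_sublist sublist_drop sublist_order.order.trans)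
  then have "length u < l"
    using short u(2) by blast
  moreover have "initial_word (length u) ((shift ^^ j) y) = u"
  proof (cases "j \<le> N")
    case True
    then have "drop j (initial_word N y) = initial_word (N - j) ((shift ^^ j) y)"
      using drop_initial_word[of j "N - j" y] by simp
    then have pre: "prefix u (initial_word (N - j) ((shift ^^ j) y))"
      using u(1) by simp
    then have "length u \<le> N - j"
      using prefix_length_le by fastforce
    then show ?thesis
      using pre take_initial_word[of "length u" "N - j"] by (metis append_eq_conv_conj prefix_def)
  next
    case False
    then have "u = []"
      using u(1) by simp
    then show ?thesis
      by (simp add: initial_word_def)
  qed
  moreover have "sublist u (initial_word M x)"
  proof -
    have "prefix (initial_word N x) (initial_word M x)"
      using take_initial_word[OF assms(2), of x] by (metis take_is_prefix)
    then show ?thesis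
      using u(2) sublist_order.order.trans by blast
  qed
  ultimately show ?thesis
    using u(3) by (intro exI[of _ u]) auto
qed

text \<open>For fixed k, comparing the window sum, about \<open>e k\<close> per letter, with its
  bound through the parsing gives c_N k (1 + 2 \<epsilon>) ln N \<ge> N (\<open>e k\<close> -
  \<open>c\<^sub>0\<close> - 2 \<epsilon>). The window length k is fixed with (\<open>e k\<close> -
  \<open>c\<^sub>0\<close>) / k above a, and only then \<epsilon> is made small.\<close>

lemma mzm_count_lower:
  assumes "a < h"
  shows "AE (x, y) in PQ. \<forall>\<^sub>F N in sequentially. a * real N \<le> real (mzm_count N y x) * ln (real N)"
proof -
  have "(\<lambda>n. e n / real n - c\<^sub>0 / real n) \<longlonglongrightarrow> h - 0"
    by (intro tendsto_intros e_tendsto lim_const_over_n)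
  then have "\<forall>\<^sub>F n in sequentially. e n / real n - c\<^sub>0 / real n > a"
    using assms by (intro order_tendstoD) auto
  then have "\<forall>\<^sub>F n in sequentially. e n / real n - c\<^sub>0 / real n > a \<and> n \<ge> 1"
    using eventually_ge_at_top[of 1] by eventually_elim auto
  then obtain k where k: "k \<ge> 1" "e k / real k - c\<^sub>0 / real k > a"
    using eventually_happens'[OF sequentially_bot] by blast
  define d where "d = e k - c\<^sub>0 - a * real k"
  have d: "d > 0"
    using k by (simp add: d_def field_simps)
  \<comment> \<open>Makes 2 \<epsilon> (1 + a k) \<le> d, which is \<open>gap\<close>; the absolute
    value keeps the denominator positive when a is negative.\<close>
  define \<epsilon> where "\<epsilon> = min (1 / 2) (d / (2 * (1 + \<bar>a\<bar> * real k)))"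
  have pos: "1 + \<bar>a\<bar> * real k > 0"
    by (simp add: add_pos_nonneg)
  have \<epsilon>: "\<epsilon> > 0" "\<epsilon> \<le> 1 / 2"
    unfolding \<epsilon>_def by (use d pos in simp, rule min.cobounded1)
  have "\<epsilon> \<le> d / (2 * (1 + \<bar>a\<bar> * real k))"
    by (simp add: \<epsilon>_def)
  then have "\<epsilon> * (2 * (1 + \<bar>a\<bar> * real k)) \<le> d"
    using pos by (simp add: pos_le_divide_eq)
  moreover have "\<epsilon> * (a * real k) \<le> \<epsilon> * (\<bar>a\<bar> * real k)"
    using \<epsilon> by (intro mult_left_mono mult_right_mono) auto
  ultimately have gap: "a * (real k * (1 + 2 * \<epsilon>)) \<le> e k - c\<^sub>0 - 2 * \<epsilon>"
    by (simp add: d_def algebra_simps)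
  \<comment> \<open>Bounds the information of a window; the added 1 makes B strictly positive for
    the asymptotic estimates below.\<close>
  define B where "B = \<kappa> * real k + 1"
  have B: "B > 0"
    using mult_nonneg_nonneg[OF \<kappa>_nonneg, of "real k"] by (simp add: B_def)
  have cost_B: "P.cost w \<le> B" if "length w \<le> k" for w
  proof -
    have "\<kappa> * real (length w) \<le> \<kappa> * real k"
      using that \<kappa>_nonneg by (intro mult_left_mono) auto
    then show ?thesis
      using P.cost_le[of w] by (simp add: B_def)
  qed
  obtain K where K: "K > 0" and short: "AE (x, y) in PQ. \<forall>\<^sub>F N in sequentially.
     \<forall>u. sublist u (initial_word N y) \<longrightarrow> sublist u (initial_word N x) \<longrightarrow> length u < log_length K N"
    using common_words_short by blast
  let ?bad = "\<lambda>x y i j. \<exists>w. length w \<le> log_length K (2 ^ i) \<and> initial_word (length w) ((shift ^^ j) y) = w \<and>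
        sublist w (initial_word (2 ^ i) x) \<and> P.cost w > (1 + \<epsilon>) * ln (2 ^ i)"
  have "AE (x, y) in PQ. \<forall>\<^sub>F i in sequentially. real (card {j. j < 2 ^ i \<and> ?bad x y i j}) < (2 ^ i) powr (1 - \<epsilon> / 2)"
    using \<epsilon> K by (intro unlikely_words_rare)
  moreover have "AE (x, y) in PQ. \<forall>\<^sub>F n in sequentially. (\<Sum>j<n. P.cost (initial_word k ((shift ^^ j) y))) \<ge> (e k - \<epsilon>) * real n"
    using \<epsilon> by (intro AE_snd window_sum_lower) auto
  ultimately show ?thesis
    using short
  proof eventually_elim
    case (elim \<omega>)
    obtain x y where \<omega>: "\<omega> = (x, y)"
      by (cases \<omega>)
    note elim = elim[unfolded \<omega> prod.case]
    obtain i\<^sub>0 where i\<^sub>0: "\<And>i. i \<ge> i\<^sub>0 \<Longrightarrow> real (card {j. j < 2 ^ i \<and> ?bad x y i j}) < (2 ^ i) powr (1 - \<epsilon> / 2)"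
      using elim(1) by (auto simp: eventually_sequentially)
    have k_real: "real k > 0"
      using k by simp
    have "\<forall>\<^sub>F N in sequentially. real k * ((1 + \<epsilon>) * ln (2 * real N)) + (real k + 1) * B \<le> real k * (1 + 2 * \<epsilon>) * ln (real N)"
      using \<epsilon> k_real by real_asymp
    \<comment> \<open>The bad positions number o(N / ln N), so charging a whole word of logarithmic
      length to each of them costs o(N).\<close>
    moreover have "\<forall>\<^sub>F N in sequentially. B * (K * ln (real N) + 1) * (2 * real N) powr (1 - \<epsilon> / 2) + real k * B \<le> \<epsilon> * real N"
      using \<epsilon> B K by real_asymp
    moreover note eventually_ge_at_top[of 1] eventually_ge_at_top[of "2 ^ i\<^sub>0"] elim(2,3)
    ultimately have "\<forall>\<^sub>F N in sequentially. a * real N \<le> real (mzm_count N y x) * ln (real N)"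
    proof eventually_elim
      case (elim N)
      note short_N = elim(6)
      define n where "n = real (mzm_count N y x)"
      obtain i where i: "2 ^ i \<le> N" "N < 2 ^ (i + 1)"
        using ex_power_ivl1[of 2 N] elim by auto
      \<comment> \<open>The next power of two, at most 2 N: this changes ln N by at most a constant
        and the bound on the bad positions by a bounded factor.\<close>
      define M :: nat where "M = 2 ^ (i + 1)"
      have M: "N \<le> M" "M \<le> 2 * N" "real M = 2 ^ (i + 1)"
        using i by (auto simp: M_def)
      have "(2::nat) ^ i\<^sub>0 < 2 ^ (i + 1)"
        using i elim by linarith
      then have lt: "i\<^sub>0 < i + 1"
        by (rule power_less_imp_less_exp[rotated]) simp
      have card_M: "real (card {j. j < M \<and> ?bad x y (i + 1) j}) < real M powr (1 - \<epsilon> / 2)"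
        unfolding M(3) unfolding M_def by (rule i\<^sub>0[OF less_imp_le[OF lt]])
      define \<theta> where "\<theta> = (1 + \<epsilon>) * ln (real M)"
      have \<theta>0: "\<theta> \<ge> 0"
        using \<epsilon> M(1) elim by (simp add: \<theta>_def)
      have \<theta>_le: "\<theta> \<le> (1 + \<epsilon>) * ln (2 * real N)"
        unfolding \<theta>_def using \<epsilon> M(1,2) elim by (intro mult_left_mono ln_mono) auto
      define bad where "bad = {j. j < N \<and> P.cost.bad_start (initial_word N x) \<theta> (drop j (initial_word N y))}"
      have "bad \<subseteq> {j. j < M \<and> ?bad x y (i + 1) j}"
      proof
        fix j assume j: "j \<in> bad"
        have "log_length K N \<le> log_length K M"
          using K M(1,2) elim by (intro log_length_mono) auto
        then have "\<forall>u. sublist u (initial_word N y) \<longrightarrow> sublist u (initial_word N x) \<longrightarrow> length u < log_length K M"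
          using short_N by (meson less_le_trans)
        then have "\<exists>w. length w \<le> log_length K M \<and> initial_word (length w) ((shift ^^ j) y) = w \<and>
            sublist w (initial_word M x) \<and> P.cost w > \<theta>"
          using j M unfolding bad_def by (intro bad_start_initial_word) auto
        then show "j \<in> {j. j < M \<and> ?bad x y (i + 1) j}"
          using j M unfolding bad_def \<theta>_def M(3) unfolding M_def by auto
      qed
      then have "card bad \<le> card {j. j < M \<and> ?bad x y (i + 1) j}"
        by (intro card_mono) auto
      then have "real (card bad) \<le> real M powr (1 - \<epsilon> / 2)"
        using card_M by simp
      also have "\<dots> \<le> (2 * real N) powr (1 - \<epsilon> / 2)"
        using M(1,2) \<epsilon> by (intro powr_mono2) auto
      finally have card_bad: "real (card bad) \<le> (2 * real N) powr (1 - \<epsilon> / 2)" .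
      have "(\<Sum>j<length (initial_word N y). P.cost (take k (drop j (initial_word N y))))
        \<le> n * (real k * \<theta> + (real k + 1) * B) + real (length (initial_word N y)) * c\<^sub>0
          + B * real (log_length K N) * real (card {j. j < length (initial_word N y) \<and>
              P.cost.bad_start (initial_word N x) \<theta> (drop j (initial_word N y))})"
        unfolding n_def mzm_count_def
        by (rule P.cost.sum_windows_le_parse[OF k(1) cost_B \<theta>0]) (use short_N in auto)
      then have "(\<Sum>j<N. P.cost (take k (drop j (initial_word N y))))
        \<le> n * (real k * \<theta> + (real k + 1) * B) + real N * c\<^sub>0 + B * real (log_length K N) * real (card bad)"
        by (simp add: bad_def)
      also have "n * (real k * \<theta> + (real k + 1) * B) \<le> n * (real k * (1 + 2 * \<epsilon>) * ln (real N))"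
      proof (rule mult_left_mono)
        have "real k * \<theta> \<le> real k * ((1 + \<epsilon>) * ln (2 * real N))"
          using \<theta>_le by (intro mult_left_mono) auto
        then show "real k * \<theta> + (real k + 1) * B \<le> real k * (1 + 2 * \<epsilon>) * ln (real N)"
          using elim(1) by linarith
      qed (simp add: n_def)
      also have "B * real (log_length K N) * real (card bad) \<le> B * (K * ln (real N) + 1) * (2 * real N) powr (1 - \<epsilon> / 2)"
        using log_length_le[of K N] K B elim card_bad by (intro mult_mono mult_left_mono) auto
      finally have "(e k - \<epsilon>) * real N - real k * B \<le> n * (real k * (1 + 2 * \<epsilon>) * ln (real N)) + real N * c\<^sub>0
          + B * (K * ln (real N) + 1) * (2 * real N) powr (1 - \<epsilon> / 2)"
        using sum_truncated_windows_ge[of k B y N, OF cost_B] B elim(5) by simp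
      then have "(e k - c\<^sub>0 - 2 * \<epsilon>) * real N \<le> n * (real k * (1 + 2 * \<epsilon>) * ln (real N))"
        using elim(2) by (simp add: algebra_simps)
      moreover have "a * (real k * (1 + 2 * \<epsilon>)) * real N \<le> (e k - c\<^sub>0 - 2 * \<epsilon>) * real N"
        using gap by (intro mult_right_mono) auto
      ultimately have "(real k * (1 + 2 * \<epsilon>)) * (a * real N) \<le> (real k * (1 + 2 * \<epsilon>)) * (n * ln (real N))"
        by (simp add: mult_ac)
      moreover have "real k * (1 + 2 * \<epsilon>) > 0"
        using k_real \<epsilon> by (intro mult_pos_pos) auto
      ultimately show ?case
        unfolding n_def by (rule mult_left_le_imp_le)
    qed
    then show ?case
      by (simp add: \<omega>)
  qed
qed

text \<open>With r_N = c_N ln N / N, the estimator equals r_N / (1 - r_N / ln N) for large N; the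
  denominator tends to 1 because c_N = o(N), which also excludes c_N = N eventually. The margins 1 /
  (m + 1) form a countable family, so a single null set suffices.\<close>

theorem mzm_estimator_tendsto:
  "AE (x, y) in PQ. (\<lambda>N. mzm_estimator N y x) \<longlonglongrightarrow> cross_entropy Q P"
proof -
  have "AE \<omega> in PQ. \<forall>m. \<forall>\<^sub>F N in sequentially. real (mzm_count N (snd \<omega>) (fst \<omega>)) * ln (real N) \<le> (h + 1 / (real m + 1)) * real N"
    unfolding AE_all_countable using mzm_count_upper by (simp add: case_prod_beta)
  moreover have "AE \<omega> in PQ. \<forall>m. \<forall>\<^sub>F N in sequentially. (h - 1 / (real m + 1)) * real N \<le> real (mzm_count N (snd \<omega>) (fst \<omega>)) * ln (real N)"
    unfolding AE_all_countable using mzm_count_lower by (simp add: case_prod_beta)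
  ultimately show ?thesis
  proof eventually_elim
    case (elim \<omega>)
    obtain x y where \<omega>: "\<omega> = (x, y)"
      by (cases \<omega>)
    define n where "n N = real (mzm_count N y x)" for N
    define r where "r N = n N * ln (real N) / real N" for N
    have r: "r \<longlonglongrightarrow> h"
    proof (rule tendstoI)
      fix \<epsilon> :: real assume "\<epsilon> > 0"
      then obtain m where m: "1 / (real m + 1) < \<epsilon>"
        using nat_approx_posE[of \<epsilon>] by (auto simp: add.commute)
      show "\<forall>\<^sub>F N in sequentially. dist (r N) h < \<epsilon>"
        using elim(1)[rule_format, of m] elim(2)[rule_format, of m] eventually_gt_at_top[of 0]
      proof eventually_elim
        case (elim N)
        then have "r N \<le> h + 1 / (real m + 1)" "h - 1 / (real m + 1) \<le> r N"
          by (auto simp: \<omega> r_def n_def pos_divide_le_eq pos_le_divide_eq)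
        with m show ?case
          by (auto simp: dist_real_def)
      qed
    qed
    have "(\<lambda>N. inverse (ln (real N))) \<longlonglongrightarrow> 0"
      by real_asymp
    then have "(\<lambda>N. r N * inverse (ln (real N))) \<longlonglongrightarrow> h * 0"
      by (intro tendsto_mult r)
    then have "(\<lambda>N. 1 - r N * inverse (ln (real N))) \<longlonglongrightarrow> 1 - h * 0"
      by (rule tendsto_diff[OF tendsto_const])
    then have den: "(\<lambda>N. 1 - r N * inverse (ln (real N))) \<longlonglongrightarrow> 1"
      by simp
    have "(\<lambda>N. r N / (1 - r N * inverse (ln (real N)))) \<longlonglongrightarrow> h / 1"
      by (intro tendsto_divide r den) simp
    then have lim: "(\<lambda>N. ereal (r N / (1 - r N * inverse (ln (real N))))) \<longlonglongrightarrow> ereal h"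
      by (intro tendsto_ereal) simp
    have "\<forall>\<^sub>F N in sequentially. 1 - r N * inverse (ln (real N)) > 0"
      using den by (rule order_tendstoD) simp
    then have "\<forall>\<^sub>F N in sequentially. ereal (r N / (1 - r N * inverse (ln (real N)))) = mzm_estimator N y x"
      using eventually_ge_at_top[of 2]
    proof eventually_elim
      case (elim N)
      have "r N * inverse (ln (real N)) = n N / real N"
        using elim by (simp add: r_def)
      then have pos: "1 - n N / real N > 0" and eq: "r N / (1 - r N * inverse (ln (real N))) = r N / (1 - n N / real N)"
        using elim by auto
      have "n N \<noteq> real N"
        using pos elim by auto
      then have "mzm_count N y x \<noteq> N"
        by (auto simp: n_def)
      moreover have "r N / (1 - n N / real N) = n N * ln (real N) / (real N - n N)"
        using elim pos by (simp add: r_def field_simps)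
      ultimately show ?case
        by (simp add: eq mzm_estimator_def n_def Let_def)
    qed
    then have "(\<lambda>N. mzm_estimator N y x) \<longlonglongrightarrow> ereal h"
      using lim by (rule Lim_transform_eventually[rotated])
    then show ?case
      by (simp add: \<omega> cross_entropy_eq)
  qed
qed

end

theorem mainTheorem2:
  fixes P Q :: "(nat \<Rightarrow> 'a::finite) measure"
    and p\<^sub>P :: "real ^ 's::finite" and T\<^sub>P :: "real ^ 's ^ 's" and R\<^sub>P :: "real ^ 'a ^ 's"
    and p\<^sub>Q :: "real ^ 't::finite" and T\<^sub>Q :: "real ^ 't ^ 't" and R\<^sub>Q :: "real ^ 'a ^ 't"
  assumes "hidden_markov_rep P p\<^sub>P T\<^sub>P R\<^sub>P" and "irreducible_matrix T\<^sub>P"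
    and "hidden_markov_rep Q p\<^sub>Q T\<^sub>Q R\<^sub>Q" and "irreducible_matrix T\<^sub>Q"
    and "seq_supp Q \<subseteq> seq_supp P"
    and "nondegenerate P Q"
  shows "AE (x, y) in P \<Otimes>\<^sub>M Q. (\<lambda>N. mzm_estimator N y x) \<longlonglongrightarrow> cross_entropy Q P"
proof -
  interpret hidden_markov_pair P Q p\<^sub>P T\<^sub>P R\<^sub>P p\<^sub>Q T\<^sub>Q R\<^sub>Q
    using assms by unfold_locales
  show ?thesis
    by (rule mzm_estimator_tendsto)
qed

end
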